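(* Let $\beta<2\sqrt{1-c^2}$ and $c^2<1$, and let $$\mathscr N=\{\vec w\in\mathscr X:\ \vec w\neq \vec 0,\ P(\vec w)=0\}.$$ For $\vec\varphi\in\mathscr X$ the following are equivalent: (i) $\vec\varphi\in\vec{\mathscr G}(\beta,c)$; (ii) $\vec\varphi\in\mathscr N$ and $L(\vec\varphi)=\inf\{L(\vec w):\vec w\in\mathscr N\}$.
   Context: Let $p>1$. Let $f\in C^2(\mathbb R)$ be homogeneous of degree $p$, meaning $f(\lambda s)=\lambda^p f(s)$ for all $\lambda>0$ and $s\in\mathbb R$. Put $F(s)=\int_0^s f$, and assume $F$ takes a positive value somewhere. Let $\mathscr X=H^2(\mathbb R)\times L^2(\mathbb R)$ with norm $\|(u,v)\|_{\mathscr X}=\|u\|_{H^2}+\|v\|_{L^2}$. Functionals of one variable: - $I(u)=\int_{\mathbb R}u_{xx}^2-\beta u_x^2+(1-c^2)u^2\,dx$; - $K(u)=(p+1)\int_{\mathbb R}F(u)\,dx$; - $m(\beta,c)=\inf\{I(u)/K(u)^{2/(p+1)}: u\in H^2(\mathbb R),\ K(u)>0\}$. Ground states: $\mathscr G(\beta,c)=\{\varphi\in H^2(\mathbb R): I(\varphi)=K(\varphi)=m(\beta,c)^{(p+1)/(p-1)}\}$. These are solutions of $(1-c^2)\varphi+\beta\varphi''+\varphi''''=f(\varphi)$. Also $\vec{\mathscr G}(\beta,c)=\{(\varphi,-c\varphi):\varphi\in\mathscr G(\beta,c)\}$. Functionals on $\mathscr X$: - $E(u,v)=\int_{\mathbb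 R}\tfrac12(u_{xx}^2-\beta u_x^2+u^2+v^2)-F(u)\,dx$; - $Q(u,v)=\int_{\mathbb R}uv\,dx$; - $L=E+cQ$; - $P(\vec w)=\langle L'(\vec w),\vec w\rangle$, which equals $I(u)-K(u)+\int(cu+v)^2\,dx$ for $\vec w=(u,v)$. *)

theory Defs
  imports "HOL-Analysis.Analysis"
begin

text \<open>Functions on the real line are handled through representatives; elements of
  L^2 / H^2 are equivalence classes modulo null sets, so equalities of elements are
  expressed almost everywhere.\<close>

definition L2 :: "(real \<Rightarrow> real) \<Rightarrow> bool" where
  "L2 u \<longleftrightarrow> u \<in> borel_measurable lborel \<and> integrable lborel (\<lambda>x. (u x)^2)"

definition test_fun :: "(real \<Rightarrow> real) \<Rightarrow> bool" where
  "test_fun \<phi> \<longleftrightarrow> (\<forall>n x. ((deriv ^^ n) \<phi>) differentiable (at x)) \<and> bounded {x. \<phi> x \<noteq> 0}"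

definition weak_deriv :: "(real \<Rightarrow> real) \<Rightarrow> (real \<Rightarrow> real) \<Rightarrow> bool" where
  "weak_deriv u v \<longleftrightarrow> (\<forall>\<phi>. test_fun \<phi> \<longrightarrow>
     (LINT x|lborel. u x * deriv \<phi> x) = - (LINT x|lborel. v x * \<phi> x))"

text \<open>A chosen L^2 weak derivative (unique up to null sets).\<close>
definition wd :: "(real \<Rightarrow> real) \<Rightarrow> (real \<Rightarrow> real)" where
  "wd u = (SOME v. L2 v \<and> weak_deriv u v)"

definition H2 :: "(real \<Rightarrow> real) \<Rightarrow> bool" where
  "H2 u \<longleftrightarrow> L2 u \<and> (\<exists>v. L2 v \<and> weak_deriv u v \<and> (\<exists>w. L2 w \<and> weak_deriv v w))"

definition inX :: "(real \<Rightarrow> real) \<times> (real \<Rightarrow> real) \<Rightarrow> bool" where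
  "inX w \<longleftrightarrow> H2 (fst w) \<and> L2 (snd w)"

definition Fprim :: "(real \<Rightarrow> real) \<Rightarrow> real \<Rightarrow> real" where
  "Fprim f s = (LBINT t=0..s. f t)"

definition Ifun :: "real \<Rightarrow> real \<Rightarrow> (real \<Rightarrow> real) \<Rightarrow> real" where
  "Ifun \<beta> c u = (LINT x|lborel. (wd (wd u) x)^2 - \<beta> * (wd u x)^2 + (1 - c^2) * (u x)^2)"

definition Kfun :: "(real \<Rightarrow> real) \<Rightarrow> real \<Rightarrow> (real \<Rightarrow> real) \<Rightarrow> real" where
  "Kfun f p u = (p + 1) * (LINT x|lborel. Fprim f (u x))"

definition mval :: "(real \<Rightarrow> real) \<Rightarrow> real \<Rightarrow> real \<Rightarrow> real \<Rightarrow> real" where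
  "mval f p \<beta> c = Inf {Ifun \<beta> c u / (Kfun f p u) powr (2 / (p + 1)) | u. H2 u \<and> Kfun f p u > 0}"

definition ground_states :: "(real \<Rightarrow> real) \<Rightarrow> real \<Rightarrow> real \<Rightarrow> real \<Rightarrow> (real \<Rightarrow> real) set" where
  "ground_states f p \<beta> c = {\<phi>. H2 \<phi> \<and> Ifun \<beta> c \<phi> = Kfun f p \<phi> \<and>
      Kfun f p \<phi> = (mval f p \<beta> c) powr ((p + 1) / (p - 1))}"

text \<open>Vector ground states (\<phi>, -c\<phi>); equality in L^2 is almost-everywhere equality.\<close>
definition vec_ground_states :: "(real \<Rightarrow> real) \<Rightarrow> real \<Rightarrow> real \<Rightarrow> real \<Rightarrow>
    ((real \<Rightarrow> real) \<times> (real \<Rightarrow> real)) set" where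
  "vec_ground_states f p \<beta> c = {(\<phi>, v). \<phi> \<in> ground_states f p \<beta> c \<and> L2 v \<and>
      (AE x in lborel. v x = - c * \<phi> x)}"

definition Efun :: "(real \<Rightarrow> real) \<Rightarrow> real \<Rightarrow> (real \<Rightarrow> real) \<times> (real \<Rightarrow> real) \<Rightarrow> real" where
  "Efun f \<beta> w = (LINT x|lborel. (1/2) * ((wd (wd (fst w)) x)^2 - \<beta> * (wd (fst w) x)^2
       + (fst w x)^2 + (snd w x)^2) - Fprim f (fst w x))"

definition Qfun :: "(real \<Rightarrow> real) \<times> (real \<Rightarrow> real) \<Rightarrow> real" where
  "Qfun w = (LINT x|lborel. fst w x * snd w x)"

definition Lfun :: "(real \<Rightarrow> real) \<Rightarrow> real \<Rightarrow> real \<Rightarrow> (real \<Rightarrow> real) \<times> (real \<Rightarrow> real) \<Rightarrow> real" where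
  "Lfun f \<beta> c w = Efun f \<beta> w + c * Qfun w"

text \<open>P(w) = <L'(w), w>, written out as I(u) - K(u) + \<integral>(cu+v)^2.\<close>
definition Pfun :: "(real \<Rightarrow> real) \<Rightarrow> real \<Rightarrow> real \<Rightarrow> real \<Rightarrow> (real \<Rightarrow> real) \<times> (real \<Rightarrow> real) \<Rightarrow> real" where
  "Pfun f p \<beta> c w = Ifun \<beta> c (fst w) - Kfun f p (fst w)
      + (LINT x|lborel. (c * fst w x + snd w x)^2)"

definition nehari :: "(real \<Rightarrow> real) \<Rightarrow> real \<Rightarrow> real \<Rightarrow> real \<Rightarrow>
    ((real \<Rightarrow> real) \<times> (real \<Rightarrow> real)) set" where
  "nehari f p \<beta> c = {w. inX w \<and> \<not> (AE x in lborel. fst w x = 0 \<and> snd w x = 0)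
      \<and> Pfun f p \<beta> c w = 0}"

end

theory Submission
  imports Defs "HOL-Computational_Algebra.Polynomial"
begin

text \<open>Write \<open>J(u,v) = \<integral>(cu+v)\<^sup>2\<close> and \<open>M = m\<^bsup>(p+1)/(p-1)\<^esup>\<close>. Completing the square gives
  \<open>L = (I + J)/2 - K/(p+1)\<close>, so on the Nehari set, where \<open>K = I + J\<close>, the action is
  \<open>L = (1/2 - 1/(p+1)) K\<close>. There \<open>I \<le> K\<close>, and \<open>m \<le> I / K\<^bsup>2/(p+1)\<^esup>\<close> forces \<open>K \<ge> M\<close>, with equality only if
  \<open>J = 0\<close> and \<open>I = K = M\<close>. Conversely, any \<open>u\<close> with \<open>K(u) > 0\<close> can be rescaled to a Nehari point
  \<open>(tu, -ctu)\<close> whose \<open>K\<close> is the \<open>(p+1)/(p-1)\<close>-th power of the quotient of \<open>u\<close>, so the infimum is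
  \<open>(1/2 - 1/(p+1)) M\<close>.

  The analytic input is \<open>m > 0\<close>. It comes from \<open>\<integral>u'\<^sup>2 = -\<integral>u u''\<close>, which makes \<open>I\<close> coercive when
  \<open>\<beta> < 2\<surd>(1-c\<^sup>2)\<close>, and from the bound of \<open>sup u\<^sup>2\<close> by the \<open>H\<^sup>1\<close> norm. Both are obtained by replacing a
  function with an \<open>L\<^sup>2\<close> weak derivative by an indefinite integral of that derivative.\<close>

section \<open>Smooth functions and test functions\<close>

text \<open>The differentiability half of \<open>test_fun\<close>, isolated because the building
  blocks of bump functions, and antiderivatives before their support is known, are not compactly
  supported.\<close>

definition smooth :: "(real \<Rightarrow> real) \<Rightarrow> bool" where
  "smooth g \<longleftrightarrow> (\<forall>n x. ((deriv ^^ n) g) differentiable (at x))"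

lemma smooth_differentiable: "smooth g \<Longrightarrow> g differentiable (at x)"
  unfolding smooth_def by (metis funpow_0)

lemma smooth_deriv: "smooth g \<Longrightarrow> smooth (deriv g)"
  unfolding smooth_def by (metis funpow_Suc_right o_apply)

lemma smooth_has_deriv: "smooth g \<Longrightarrow> (g has_real_derivative deriv g x) (at x)"
  using smooth_differentiable DERIV_deriv_iff_real_differentiable by blast

lemma smooth_isCont: "smooth g \<Longrightarrow> isCont g x"
  using smooth_has_deriv DERIV_isCont by blast

lemma smooth_continuous_on: "smooth g \<Longrightarrow> continuous_on A g"
  using smooth_isCont continuous_at_imp_continuous_on by blast

text \<open>By induction on \<open>n\<close> every iterated derivative of \<open>g\<close> stays in
  \<open>S\<close>, and each member of \<open>S\<close> is differentiable. This replaces explicit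
  formulas for the n-th derivative.\<close>

lemma smooth_coinduct:
  assumes "S g" and "\<And>h. S h \<Longrightarrow> \<exists>h'. S h' \<and> (\<forall>x. (h has_real_derivative h' x) (at x))"
  shows "smooth g"
proof -
  have d: "\<exists>h'. deriv h = h' \<and> S h' \<and> (\<forall>x. h differentiable (at x))" if S: "S h" for h
  proof -
    obtain h' where h': "S h'" "\<forall>x. (h has_real_derivative h' x) (at x)" using assms(2) S by blast
    hence "deriv h = h'" using DERIV_imp_deriv by blast
    thus ?thesis using h' real_differentiable_def by blast
  qed
  have "S ((deriv ^^ n) g)" for n
    by (induction n) (use assms(1) d in auto)
  thus ?thesis unfolding smooth_def using d by blast
qed

text \<open>Coinduction needs a set of functions closed under differentiation; the products alone are not.\<close>
inductive smooth_span :: "(real \<Rightarrow> real) \<Rightarrow> bool" where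
  affine: "smooth g \<Longrightarrow> smooth_span (\<lambda>x. k * g (a * x + b))"
| prod: "smooth g \<Longrightarrow> smooth h \<Longrightarrow> smooth_span (\<lambda>x. g x * h x)"
| plus: "smooth_span g \<Longrightarrow> smooth_span h \<Longrightarrow> smooth_span (\<lambda>x. g x + h x)"

lemma smooth_span_smooth:
  assumes "smooth_span g"
  shows "smooth g"
proof (rule smooth_coinduct[of smooth_span, OF assms])
  fix h assume "smooth_span h"
  thus "\<exists>h'. smooth_span h' \<and> (\<forall>x. (h has_real_derivative h' x) (at x))"
  proof induction
    case (affine g k a b)
    have "((\<lambda>x. k * g (a * x + b)) has_real_derivative (k * a) * deriv g (a * x + b)) (at x)" for x
      by (auto intro!: derivative_eq_intros DERIV_chain2[OF smooth_has_deriv[OF affine]])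
    moreover have "smooth_span (\<lambda>x. (k * a) * deriv g (a * x + b))"
      by (rule smooth_span.affine[OF smooth_deriv[OF affine]])
    ultimately show ?case by blast
  next
    case (prod g h)
    have "((\<lambda>x. g x * h x) has_real_derivative deriv g x * h x + g x * deriv h x) (at x)" for x
      using DERIV_mult[OF smooth_has_deriv[OF prod(1)] smooth_has_deriv[OF prod(2)]]
      by (simp add: algebra_simps)
    moreover have "smooth_span (\<lambda>x. deriv g x * h x + g x * deriv h x)"
      using prod by (intro smooth_span.plus smooth_span.prod smooth_deriv)
    ultimately show ?case by blast
  next
    case (plus g h)
    then obtain g' h' where "smooth_span g'" "smooth_span h'"
       "\<forall>x. (g has_real_derivative g' x) (at x)" "\<forall>x. (h has_real_derivative h' x) (at x)" by blast
    hence "smooth_span (\<lambda>x. g' x + h' x)"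
      "\<forall>x. ((\<lambda>x. g x + h x) has_real_derivative g' x + h' x) (at x)"
      by (auto intro: smooth_span.plus DERIV_add)
    thus ?case by blast
  qed
qed

lemma smooth_affine: "smooth g \<Longrightarrow> smooth (\<lambda>x. k * g (a * x + b))"
  by (rule smooth_span_smooth) (rule smooth_span.affine)

lemma smooth_mult: "smooth g \<Longrightarrow> smooth h \<Longrightarrow> smooth (\<lambda>x. g x * h x)"
  by (rule smooth_span_smooth) (rule smooth_span.prod)

lemma smooth_diff:
  assumes "smooth g" "smooth h" shows "smooth (\<lambda>x. g x - k * h x)"
  using smooth_span_smooth[OF smooth_span.plus[OF smooth_span.affine[OF assms(1), of 1 1 0]
      smooth_span.affine[OF assms(2), of "-k" 1 0]]] by simp

lemma smooth_antideriv:
  assumes "\<And>x. (g has_real_derivative h x) (at x)" "smooth h"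
  shows "smooth g"
  by (rule smooth_coinduct[of "\<lambda>k. k = g \<or> smooth k"])
    (use assms smooth_deriv smooth_has_deriv in blast)+

section \<open>Bump functions built from exp(-1/x)\<close>

definition exp_recip :: "real poly \<Rightarrow> real \<Rightarrow> real" where
  "exp_recip q x = (if x > 0 then poly q (1 / x) * exp (- (1 / x)) else 0)"


lemma poly_exp_tendsto_0: "((\<lambda>y::real. poly q y * exp (- y)) \<longlongrightarrow> 0) at_top"
proof -
  have "((\<lambda>y::real. \<Sum>i\<le>degree q. coeff q i * (y ^ i / exp y)) \<longlongrightarrow> (\<Sum>i\<le>degree q. coeff q i * 0)) at_top"
    by (intro tendsto_sum tendsto_mult tendsto_const tendsto_power_div_exp_0)
  thus ?thesis by (simp add: poly_altdef sum_distrib_right exp_minus divide_inverse mult.assoc)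
qed

lemma DERIV_eventually_eq:
  assumes "(g has_real_derivative D) (at x)" "eventually (\<lambda>y. g y = h y) (nhds x)"
  shows "(h has_real_derivative D) (at x)"
  using assms DERIV_cong_ev[OF refl assms(2) refl] by simp

text \<open>With y = 1/x the derivative of q(y) exp(-y) is y^2 (q(y) - q'(y)) exp(-y), so polynomial
  factors in 1/x make the family closed under differentiation. Its case \<open>q = 1\<close> is the
  classical flat function exp(-1/x).\<close>

lemma exp_recip_has_deriv:
  "(exp_recip q has_real_derivative exp_recip ([:0, 0, 1:] * (q - pderiv q)) x) (at x)"
proof -
  consider "x > 0" | "x < 0" | "x = 0" by linarith
  thus ?thesis
  proof cases
    case 1
    have "((\<lambda>x. poly q (1 / x) * exp (- (1 / x))) has_real_derivative
      exp_recip ([:0, 0, 1:] * (q - pderiv q)) x) (at x)"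
      using 1 unfolding exp_recip_def
      by (auto intro!: derivative_eq_intros DERIV_chain2[OF poly_DERIV]
          simp: field_simps power2_eq_square)
    moreover have "eventually (\<lambda>y. poly q (1 / y) * exp (- (1 / y)) = exp_recip q y) (nhds x)"
      using 1 by (intro eventually_mono[OF eventually_nhds_in_open[of "{0<..}"]])
        (auto simp: exp_recip_def)
    ultimately show ?thesis by (rule DERIV_eventually_eq)
  next
    case 2
    have "((\<lambda>x. 0) has_real_derivative exp_recip ([:0, 0, 1:] * (q - pderiv q)) x) (at x)"
      using 2 unfolding exp_recip_def by auto
    moreover have "eventually (\<lambda>y. 0 = exp_recip q y) (nhds x)"
      using 2 by (intro eventually_mono[OF eventually_nhds_in_open[of "{..<0}"]])
        (auto simp: exp_recip_def)
    ultimately show ?thesis by (rule DERIV_eventually_eq)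
  next
    case 3
    \<comment> \<open>Dividing by y in the right difference quotient at 0 only multiplies the
      polynomial in 1/y by one more factor 1/y, hence \<open>[:0, 1:] * q\<close>.\<close>
    have "((\<lambda>y. poly ([:0, 1:] * q) (inverse y) * exp (- inverse y)) \<longlongrightarrow> 0) (at_right (0::real))"
      using filterlim_compose[OF poly_exp_tendsto_0 filterlim_inverse_at_top_right] .
    hence "((\<lambda>y. (exp_recip q (0 + y) - exp_recip q 0) / y) \<longlongrightarrow> 0) (at_right 0)"
      by (rule Lim_transform_eventually)
        (auto simp: exp_recip_def eventually_at_right_field field_simps intro!: exI[of _ 1])
    moreover have "((\<lambda>y. (exp_recip q (0 + y) - exp_recip q 0) / y) \<longlongrightarrow> 0) (at_left 0)"
      by (rule Lim_transform_eventually[OF tendsto_const])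
        (auto simp: exp_recip_def eventually_at_left_field intro!: exI[of _ "-1"])
    ultimately have "((\<lambda>y. (exp_recip q (0 + y) - exp_recip q 0) / y) \<longlongrightarrow> 0) (at 0)"
      by (simp add: filterlim_split_at)
    thus ?thesis using 3 by (simp add: DERIV_def exp_recip_def)
  qed
qed

lemma smooth_exp_recip: "smooth (exp_recip q)"
  by (rule smooth_coinduct[of "\<lambda>h. \<exists>q. h = exp_recip q"]) (use exp_recip_has_deriv in blast)+

text \<open>The dilation by \<open>n + 1\<close> makes these increase to the indicator of \<open>(a, b)\<close>, so that testing
  against them determines integrals over intervals.\<close>
definition bump :: "real \<Rightarrow> real \<Rightarrow> nat \<Rightarrow> real \<Rightarrow> real" where
  "bump a b n x = exp_recip 1 (real (Suc n) * (x - a)) * exp_recip 1 (real (Suc n) * (b - x))"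

lemma test_fun_smooth: "test_fun g \<longleftrightarrow> smooth g \<and> bounded {x. g x \<noteq> 0}"
  by (simp add: test_fun_def smooth_def)

lemma bump_zero: "x \<notin> {a<..<b} \<Longrightarrow> bump a b n x = 0"
  by (auto simp: bump_def exp_recip_def zero_less_mult_iff)

lemma bump_pos: "x \<in> {a<..<b} \<Longrightarrow> bump a b n x > 0"
  by (auto simp: bump_def exp_recip_def zero_less_mult_iff)

lemma bump_nonneg: "bump a b n x \<ge> 0"
  by (auto simp: bump_def exp_recip_def)

lemma bump_le_1: "bump a b n x \<le> 1"
  by (auto simp: bump_def exp_recip_def intro!: mult_le_one)

lemma smooth_bump: "smooth (bump a b n)"
proof -
  have "smooth (\<lambda>x. (1 * exp_recip 1 (real (Suc n) * x + - real (Suc n) * a)) *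
     (1 * exp_recip 1 ((- real (Suc n)) * x + real (Suc n) * b)))"
    by (intro smooth_mult smooth_affine smooth_exp_recip)
  also have "(\<lambda>x. (1 * exp_recip 1 (real (Suc n) * x + - real (Suc n) * a)) *
     (1 * exp_recip 1 ((- real (Suc n)) * x + real (Suc n) * b))) = bump a b n"
    unfolding bump_def by (intro ext) (simp only: mult_1 right_diff_distrib, simp add: algebra_simps)
  finally show ?thesis .
qed

lemma test_fun_bump: "test_fun (bump a b n)"
proof -
  have "{x. bump a b n x \<noteq> 0} \<subseteq> {a<..<b}" using bump_zero by blast
  thus ?thesis using smooth_bump test_fun_smooth bounded_subset[OF bounded_box[of a b]] by (auto simp: box_real)
qed

lemma bump_tendsto: "(\<lambda>n. bump a b n x) \<longlonglongrightarrow> indicator {a<..<b} x"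
proof (cases "x \<in> {a<..<b}")
  case True
  have "(\<lambda>n. exp (- (1 / (real (Suc n) * d)))) \<longlonglongrightarrow> 1" if "d > 0" for d
  proof -
    have "(\<lambda>n. exp (- ((1 / d) * (1 / real (Suc n))))) \<longlonglongrightarrow> exp (- ((1 / d) * 0))"
      by (intro tendsto_intros LIMSEQ_Suc[OF lim_1_over_n] )
    thus ?thesis by (simp add: field_simps)
  qed
  hence "(\<lambda>n. exp (- (1 / (real (Suc n) * (x - a)))) * exp (- (1 / (real (Suc n) * (b - x)))))
      \<longlonglongrightarrow> 1 * 1"
    using True by (intro tendsto_mult) auto
  thus ?thesis using True unfolding bump_def exp_recip_def by (simp add: zero_less_mult_iff del: of_nat_Suc)
qed (simp add: bump_zero)

section \<open>Derivatives and antiderivatives of test functions\<close>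

lemma test_fun_support:
  assumes "test_fun g"
  obtains R where "R > 0" "\<And>x. \<bar>x\<bar> \<ge> R \<Longrightarrow> g x = 0"
proof -
  obtain R where "R > 0" "\<And>x. g x \<noteq> 0 \<Longrightarrow> norm x < R"
    using assms unfolding test_fun_smooth bounded_pos_less by blast
  thus ?thesis using that[of R] by force
qed

lemma test_fun_deriv: 
  assumes "test_fun g" shows "test_fun (deriv g)"
proof -
  obtain R where R: "R > 0" "\<And>x. \<bar>x\<bar> \<ge> R \<Longrightarrow> g x = 0" using test_fun_support[OF assms] by blast
  \<comment> \<open>The strict inequality makes the region open, so \<open>g\<close> vanishes near
    \<open>x\<close> and not merely at \<open>x\<close>.\<close>
  have "deriv g x = 0" if "\<bar>x\<bar> > R" for x
  proof -
    have "((\<lambda>x. 0) has_real_derivative 0) (at x)" by simp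
    moreover have "eventually (\<lambda>y. 0 = g y) (nhds x)"
      using that R by (intro eventually_mono[OF eventually_nhds_in_open[of "{y. R < \<bar>y\<bar>}"]])
        (auto intro!: open_Collect_less continuous_intros)
    ultimately have "(g has_real_derivative 0) (at x)" by (rule DERIV_eventually_eq)
    thus ?thesis by (rule DERIV_imp_deriv)
  qed
  hence "{x. deriv g x \<noteq> 0} \<subseteq> {-R..R}" by (force simp: not_less[symmetric])
  thus ?thesis using assms smooth_deriv bounded_subset bounded_closed_interval unfolding test_fun_smooth by blast
qed

text \<open>The antiderivative that vanishes to the left of the support equals the full integral of
  \<open>g\<close> to the right of it, so mean zero is what gives it bounded support.\<close>

lemma test_fun_antideriv:
  assumes g: "test_fun g" and z: "(LINT x|lborel. g x) = 0"
  shows "\<exists>G. test_fun G \<and> deriv G = g"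
proof -
  obtain R where R: "R > 0" "\<And>x. \<bar>x\<bar> \<ge> R \<Longrightarrow> g x = 0" using test_fun_support[OF g] by blast
  have sg: "smooth g" using g test_fun_smooth by blast
  have "\<exists>F. \<forall>x::real. -\<infinity> < ereal x \<longrightarrow> ereal x < \<infinity> \<longrightarrow> (F has_vector_derivative g x) (at x)"
    by (rule einterval_antiderivative) (auto simp: smooth_isCont sg)
  then obtain F where F: "\<And>x. (F has_real_derivative g x) (at x)"
    by (auto simp: has_real_derivative_iff_has_vector_derivative)
  define G where "G x = F x - F (-R)" for x
  have dG: "(G has_real_derivative g x) (at x)" for x unfolding G_def using F
    by (auto intro!: derivative_eq_intros)
  have FTC: "(LINT x|lborel. g x * indicator {a..b} x) = G b - G a" if "a \<le> b" for a b
    using that by (intro integral_FTC_Icc_real dG) (auto simp: smooth_isCont sg)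
  have "G x = 0" if "\<bar>x\<bar> \<ge> R" for x
  proof (cases "x \<ge> R")
    case True
    have "(\<lambda>y. g y * indicator {-R..x} y) = g" using True R by (force simp: indicator_def)
    thus ?thesis using FTC[of "-R" x] True R z by (simp add: G_def)
  next
    case False
    hence "x \<le> -R" using that by auto
    hence "g y * indicator {x..-R} y = 0" for y using R(1) R(2)[of y] by (auto simp: indicator_def)
    hence "(LINT y|lborel. g y * indicator {x..-R} y) = 0" by (simp only: integral_zero)
    thus ?thesis using FTC[of x "-R"] \<open>x \<le> -R\<close> by (simp add: G_def)
  qed
  hence "{x. G x \<noteq> 0} \<subseteq> {-R..R}" by (force simp: not_le[symmetric])
  hence "bounded {x. G x \<noteq> 0}" using bounded_subset bounded_closed_interval by blast
  moreover have "smooth G" by (rule smooth_antideriv[OF dG sg])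
  moreover have "deriv G = g" using dG DERIV_imp_deriv by blast
  ultimately show ?thesis using test_fun_smooth by blast
qed

section \<open>Locally integrable functions and their primitives\<close>

definition loc_int :: "(real \<Rightarrow> real) \<Rightarrow> bool" where
  "loc_int v \<longleftrightarrow> v \<in> borel_measurable borel \<and> (\<forall>a b. integrable lborel (\<lambda>x. indicator {a..b} x * v x))"

lemma loc_int_measurable [measurable_dest]: "loc_int v \<Longrightarrow> v \<in> borel_measurable borel"
  by (simp add: loc_int_def)

lemma loc_int_bounded_set:
  assumes "loc_int v" "A \<in> sets borel" "A \<subseteq> {a..b}"
  shows "integrable lborel (\<lambda>x. indicator A x * v x)"
proof (rule Bochner_Integration.integrable_bound)
  show "integrable lborel (\<lambda>x. indicator {a..b} x * v x)" using assms(1) by (simp add: loc_int_def)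
  show "(\<lambda>x. indicator A x * v x) \<in> borel_measurable lborel" 
    using assms(1,2) by (auto simp: loc_int_def)
  show "AE x in lborel. norm (indicator A x * v x) \<le> norm (indicator {a..b} x * v x)"
    using subsetD[OF assms(3)] by (intro AE_I2) (simp add: indicator_def)
qed

lemma loc_int_Ioc: "loc_int v \<Longrightarrow> integrable lborel (\<lambda>x. indicator {a<..b} x * v x)"
  by (rule loc_int_bounded_set[of _ _ a b]) auto

lemma loc_int_mult_bounded:
  assumes "loc_int v" and [measurable]: "g \<in> borel_measurable borel"
    and B: "\<And>x. x \<in> {a..b} \<Longrightarrow> \<bar>g x\<bar> \<le> B"
  shows "integrable lborel (\<lambda>x. indicator {a..b} x * (v x * g x))"
proof (rule Bochner_Integration.integrable_bound)
  show "integrable lborel (\<lambda>x. B * (indicator {a..b} x * v x))" using assms(1) by (simp add: loc_int_def)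
  have [measurable]: "v \<in> borel_measurable borel" using assms(1) by (simp add: loc_int_def)
  show "(\<lambda>x. indicator {a..b} x * (v x * g x)) \<in> borel_measurable lborel" by measurable
  have "norm (indicator {a..b} x * (v x * g x)) \<le> norm (B * (indicator {a..b} x * v x))" for x
  proof (cases "x \<in> {a..b}")
    case True
    have "\<bar>g x\<bar> * \<bar>v x\<bar> \<le> B * \<bar>v x\<bar>" using B[OF True] by (intro mult_right_mono) auto
    moreover have "B \<ge> 0" using B[OF True] by auto
    ultimately show ?thesis using True by (auto simp: abs_mult mult_ac)
  qed auto
  thus "AE x in lborel. norm (indicator {a..b} x * (v x * g x)) \<le> norm (B * (indicator {a..b} x * v x))"
    by simp
qed

lemma loc_int_diff: "loc_int u \<Longrightarrow> loc_int v \<Longrightarrow> loc_int (\<lambda>x. u x - v x)"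
  by (auto simp: loc_int_def right_diff_distrib)

lemma loc_int_const: "loc_int (\<lambda>x. k)"
  by (auto simp: loc_int_def emeasure_lborel_Icc_eq intro!: integrable_mult_left integrable_real_indicator)

lemma continuous_bounded_Icc:
  assumes "continuous_on UNIV (g :: real \<Rightarrow> real)"
  obtains B where "\<And>x. x \<in> {a..b} \<Longrightarrow> \<bar>g x\<bar> \<le> B"
proof -
  have "bounded (g ` {a..b})"
    by (intro compact_imp_bounded compact_continuous_image continuous_on_subset[OF assms]) auto
  then obtain B where "\<forall>y\<in>g ` {a..b}. norm y \<le> B" unfolding bounded_iff by blast
  thus ?thesis using that[of B] by auto
qed

lemma smooth_measurable: "smooth g \<Longrightarrow> g \<in> borel_measurable borel"
  using smooth_continuous_on borel_measurable_continuous_onI by blast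

lemma loc_int_mult_test:
  assumes v: "loc_int v" and g: "test_fun g"
  shows "integrable lborel (\<lambda>x. v x * g x)"
proof -
  obtain R where R: "R > 0" "\<And>x. \<bar>x\<bar> \<ge> R \<Longrightarrow> g x = 0" using test_fun_support[OF g] by blast
  have s: "smooth g" using g test_fun_smooth by blast
  obtain B where "\<And>x. x \<in> {-R..R} \<Longrightarrow> \<bar>g x\<bar> \<le> B"
    using continuous_bounded_Icc smooth_continuous_on[OF s] by blast
  hence "integrable lborel (\<lambda>x. indicator {-R..R} x * (v x * g x))"
    by (intro loc_int_mult_bounded v smooth_measurable s)
  moreover have "indicator {-R..R} x * (v x * g x) = v x * g x" for x
    using R(2)[of x] by (cases "\<bar>x\<bar> \<ge> R") (auto simp: indicator_def)
  ultimately show ?thesis by simp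
qed

text \<open>Open intervals form an intersection-stable generator of the Borel sets, so the sets over
  which \<open>h\<close> integrates to zero include all Borel sets by a Dynkin argument; a density
  with this property vanishes almost everywhere.\<close>

lemma AE_zero_if_integral_intervals_zero:
  assumes h: "loc_int h" and z: "\<And>a b. (LINT x|lborel. indicator {a<..<b} x * h x) = 0"
  shows "AE x in lborel. h x = 0"
proof -
  have [measurable]: "h \<in> borel_measurable borel" using h by (simp add: loc_int_def)
  \<comment> \<open>Truncation to (-N, N) turns local into global integrability, which additivity
    over complements and countable unions requires. The countably many exceptional null sets are
    combined at the end.\<close>
  have "AE x in lborel. indicator {- real N<..<real N} x * h x = 0" for N :: nat
  proof (rule sigma_finite_measure.density_zero[OF sigma_finite_lborel])
    let ?h = "\<lambda>x. indicator {- real N<..<real N} x * h x"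
    show int: "integrable lborel ?h"
      by (rule loc_int_bounded_set[OF h, of _ "- real N" "real N"]) auto
    have seti: "set_integrable lborel A ?h" if "A \<in> sets lborel" for A
      unfolding set_integrable_def using int that by (rule integrable_mult_indicator[rotated])
    have stable: "Int_stable (range (\<lambda>(a, b). box a b :: real set))"
      by (auto simp: Int_stable_def box_Int_box)
    have subset_Pow: "range (\<lambda>(a, b). box a b :: real set) \<subseteq> Pow UNIV" by simp
    fix A :: "real set" assume "A \<in> sets lborel"
    hence "A \<in> sigma_sets UNIV (range (\<lambda>(a, b). box a b))"
      by (simp add: borel_eq_box)
    thus "set_lebesgue_integral lborel A ?h = 0"
    proof (induction rule: sigma_sets_induct_disjoint[OF stable subset_Pow, consumes 1, case_names basic empty compl union])
      case (basic A)
      then obtain a b where "A = {a<..<b}" by (auto simp: box_real)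
      hence "set_lebesgue_integral lborel A ?h
        = (LINT x|lborel. indicator {max a (- real N)<..<min b (real N)} x * h x)"
        unfolding set_lebesgue_integral_def
        by (intro Bochner_Integration.integral_cong) (auto simp: indicator_def)
      thus ?case using z by simp
    next
      case (compl A)
      hence A: "A \<in> sets lborel" by (simp add: borel_eq_box)
      \<comment> \<open>The integral of the truncated function over the whole line is zero by
        \<open>z\<close>, so a complement inherits zero from \<open>A\<close>.\<close>
      have "set_lebesgue_integral lborel (A \<union> (UNIV - A)) ?h =
         set_lebesgue_integral lborel A ?h + set_lebesgue_integral lborel (UNIV - A) ?h"
        by (intro set_integral_Un seti) (use A in auto)
      thus ?case using compl z by (simp add: set_lebesgue_integral_def)
    next
      case (union A)
      hence A: "A i \<in> sets lborel" for i by (auto simp: borel_eq_box)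
      have "set_lebesgue_integral lborel (\<Union>i. A i) ?h = (\<Sum>i. set_lebesgue_integral lborel (A i) ?h)"
        using union(1) A seti by (intro lebesgue_integral_countable_add) (auto simp: disjoint_family_on_def)
      thus ?case using union by simp
    qed (simp add: set_lebesgue_integral_def)
  qed
  hence "AE x in lborel. \<forall>N::nat. indicator {- real N<..<real N} x * h x = 0"
    by (intro AE_all_countable[THEN iffD2] allI)
  thus ?thesis
  proof (rule AE_mp, intro AE_I2 impI)
    fix x assume *: "\<forall>N::nat. indicator {- real N<..<real N} x * h x = 0"
    obtain N :: nat where "\<bar>x\<bar> < real N" using reals_Archimedean2 by blast
    thus "h x = 0" using *[rule_format, of N] by (auto simp: indicator_def split: if_splits)
  qed
qed

text \<open>Bumps on (a, b) are admissible test functions and converge to the indicator of (a, b),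
  so dominated convergence turns the hypothesis into vanishing integrals over intervals.\<close>

lemma fundamental_lemma:
  assumes h: "loc_int h" and z: "\<And>g. test_fun g \<Longrightarrow> (LINT x|lborel. h x * g x) = 0"
  shows "AE x in lborel. h x = 0"
proof (rule AE_zero_if_integral_intervals_zero[OF h])
  fix a b :: real
  have [measurable]: "h \<in> borel_measurable borel" "\<And>n. bump a b n \<in> borel_measurable borel"
    using h smooth_measurable[OF smooth_bump] by (auto simp: loc_int_def)
  have "(\<lambda>n. LINT x|lborel. h x * bump a b n x) \<longlonglongrightarrow> (LINT x|lborel. indicator {a<..<b} x * h x)"
  proof (rule integral_dominated_convergence)
    show "integrable lborel (\<lambda>x. \<bar>indicator {a..b} x * h x\<bar>)" using h by (auto simp: loc_int_def)
    show "AE x in lborel. (\<lambda>n. h x * bump a b n x) \<longlonglongrightarrow> indicator {a<..<b} x * h x"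
    proof (intro AE_I2)
      fix x show "(\<lambda>n. h x * bump a b n x) \<longlonglongrightarrow> indicator {a<..<b} x * h x"
        using tendsto_mult[OF tendsto_const[of "h x"] bump_tendsto[of a b x]] by (simp add: mult.commute)
    qed
    show "AE x in lborel. norm (h x * bump a b n x) \<le> \<bar>indicator {a..b} x * h x\<bar>" for n
    proof (intro AE_I2)
      fix x
      show "norm (h x * bump a b n x) \<le> \<bar>indicator {a..b} x * h x\<bar>"
      proof (cases "x \<in> {a<..<b}")
        case True
        thus ?thesis using mult_left_mono[OF bump_le_1[of a b n x], of "\<bar>h x\<bar>"] bump_nonneg[of a b n x]
          by (auto simp: abs_mult)
      qed (simp add: bump_zero)
    qed
  qed measurable
  moreover have "(LINT x|lborel. h x * bump a b n x) = 0" for n by (rule z[OF test_fun_bump])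
  ultimately show "(LINT x|lborel. indicator {a<..<b} x * h x) = 0"
    by (simp add: LIMSEQ_const_iff)
qed

lemma test_fun_integrable: "test_fun g \<Longrightarrow> integrable lborel g"
  using loc_int_mult_test[OF loc_int_const, of g 1] by simp

lemma integral_pos_on_interval:
  fixes g :: "real \<Rightarrow> real"
  assumes i: "integrable lborel g" and nn: "\<And>x. g x \<ge> 0" and p: "\<And>x. x \<in> {a<..<b} \<Longrightarrow> g x > 0" and "a < b"
  shows "(LINT x|lborel. g x) > 0"
proof (rule ccontr)
  assume "\<not> ?thesis"
  moreover have "(LINT x|lborel. g x) \<ge> 0" by (intro integral_nonneg_AE AE_I2 nn)
  ultimately have "(LINT x|lborel. g x) = 0" by simp
  hence "AE x in lborel. g x = 0" using integral_nonneg_eq_0_iff_AE[OF i] nn by auto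
  hence "AE x in lborel. x \<notin> {a<..<b}" by (rule AE_mp) (use p in force)
  hence "{a<..<b} \<in> null_sets lborel" by (simp add: AE_iff_null_sets)
  thus False using \<open>a < b\<close> by (simp add: null_sets_def)
qed

text \<open>The du Bois-Reymond lemma: subtracting a multiple of a fixed bump \<open>e\<close> from
  any test function leaves one of mean zero, hence the derivative of a test function, against which
  \<open>h\<close> integrates to zero.\<close>

lemma weak_deriv_zero_const:
  assumes h: "loc_int h" and z: "\<And>g. test_fun g \<Longrightarrow> (LINT x|lborel. h x * deriv g x) = 0"
  shows "\<exists>k. AE x in lborel. h x = k"
proof -
  define e where "e = bump 0 1 0"
  have e: "test_fun e" unfolding e_def by (rule test_fun_bump)
  define J where "J = (LINT x|lborel. e x)"
  have "J > 0" unfolding J_def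
    by (rule integral_pos_on_interval[OF test_fun_integrable[OF e], of 0 1])
       (auto simp: e_def bump_nonneg bump_pos)
  \<comment> \<open>The \<open>e\<close>-weighted mean of \<open>h\<close>, the only candidate for
    the constant.\<close>
  define k where "k = (LINT x|lborel. h x * e x) / J"
  have "(LINT x|lborel. (h x - k) * g x) = 0" if g: "test_fun g" for g
  proof -
    \<comment> \<open>Chosen so that \<open>g - c * e\<close> has mean zero.\<close>
    define c where "c = (LINT x|lborel. g x) / J"
    have ig: "integrable lborel g" "integrable lborel e" by (intro test_fun_integrable g e)+
    have ih: "integrable lborel (\<lambda>x. h x * g x)" "integrable lborel (\<lambda>x. h x * e x)"
      by (intro loc_int_mult_test h g e)+
    have "test_fun (\<lambda>x. g x - c * e x)" 
    proof -
      have "{x. g x - c * e x \<noteq> 0} \<subseteq> {x. g x \<noteq> 0} \<union> {x. e x \<noteq> 0}" by auto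
      thus ?thesis using g e smooth_diff unfolding test_fun_smooth
        by (meson bounded_Un bounded_subset)
    qed
    moreover have "(LINT x|lborel. g x - c * e x) = 0"
      using ig \<open>J > 0\<close> by (simp add: c_def J_def)
    ultimately obtain G where G: "test_fun G" "deriv G = (\<lambda>x. g x - c * e x)"
      using test_fun_antideriv by blast
    have "0 = (LINT x|lborel. h x * (g x - c * e x))" using z[OF G(1)] G(2) by simp
    also have "\<dots> = (LINT x|lborel. h x * g x) - c * (LINT x|lborel. h x * e x)"
      using ih by (simp add: right_diff_distrib mult.left_commute)
    also have "\<dots> = (LINT x|lborel. h x * g x) - k * (LINT x|lborel. g x)"
      using \<open>J > 0\<close> by (simp add: c_def k_def)
    also have "\<dots> = (LINT x|lborel. (h x - k) * g x)"
      using ih ig by (simp add: left_diff_distrib)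
    finally show ?thesis by simp
  qed
  hence "AE x in lborel. h x - k = 0"
    by (intro fundamental_lemma loc_int_diff h loc_int_const)
  thus ?thesis by auto
qed

section \<open>Indefinite integrals and their product rule\<close>

definition primitive_of :: "(real \<Rightarrow> real) \<Rightarrow> (real \<Rightarrow> real) \<Rightarrow> bool" where
  "primitive_of v U \<longleftrightarrow> loc_int v \<and> (\<forall>a b. a \<le> b \<longrightarrow> U b - U a = (LINT x|lborel. indicator {a<..b} x * v x))"

lemma primitive_ofD:
  "primitive_of v U \<Longrightarrow> a \<le> b \<Longrightarrow> U b = U a + (LINT x|lborel. indicator {a<..b} x * v x)"
  unfolding primitive_of_def by (metis add.commute diff_add_cancel)

text \<open>The difference of indicators yields the oriented integral from 0 to \<open>x\<close> for
  both signs of \<open>x\<close> in one formula.\<close>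

definition prim :: "(real \<Rightarrow> real) \<Rightarrow> real \<Rightarrow> real" where
  "prim v x = (LINT s|lborel. (indicator {0<..x} s - indicator {x<..0} s) * v s)"

lemma primitive_of_prim:
  assumes v: "loc_int v" shows "primitive_of v (prim v)"
  unfolding primitive_of_def
proof (intro conjI allI impI v)
  fix a b :: real assume "a \<le> b"
  have i: "integrable lborel (\<lambda>s. (indicator {0<..x} s - indicator {x<..0} s) * v s)" for x
    using loc_int_Ioc[OF v] by (simp add: left_diff_distrib)
  have "prim v b - prim v a = (LINT s|lborel. (indicator {0<..b} s - indicator {b<..0} s) * v s
      - (indicator {0<..a} s - indicator {a<..0} s) * v s)"
    unfolding prim_def using i by simp
  also have "\<dots> = (LINT x|lborel. indicator {a<..b} x * v x)"
    using \<open>a \<le> b\<close> by (intro Bochner_Integration.integral_cong) (auto simp: indicator_def)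
  finally show "prim v b - prim v a = (LINT x|lborel. indicator {a<..b} x * v x)" .
qed

lemma prim_measurable:
  assumes [measurable]: "v \<in> borel_measurable borel" shows "prim v \<in> borel_measurable borel"
proof -
  \<comment> \<open>Comparisons under \<open>of_bool\<close> expose joint measurability in
    \<open>x\<close> and \<open>s\<close>, which the moving intervals hide.\<close>
  have "(\<lambda>x. LINT s|lborel. (of_bool (0 < s \<and> s \<le> x) - of_bool (x < s \<and> s \<le> 0)) * v s) \<in> borel_measurable borel"
    by measurable
  thus ?thesis unfolding prim_def[abs_def] by (simp add: indicator_def of_bool_def)
qed

lemma primitive_of_measurable:
  assumes "primitive_of v U" shows "U \<in> borel_measurable borel"
proof -
  have v: "loc_int v" using assms by (simp add: primitive_of_def)
  have "U x = U 0 + prim v x - prim v 0" for x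
    using assms primitive_of_prim[OF v] unfolding primitive_of_def
    by (cases "0 \<le> x") (smt (verit))+
  hence "U = (\<lambda>x. U 0 + prim v x - prim v 0)" by blast
  moreover have "(\<lambda>x. U 0 + prim v x - prim v 0) \<in> borel_measurable borel"
    using prim_measurable[of v] v by (auto simp: loc_int_def)
  ultimately show ?thesis by simp
qed

lemma primitive_of_bounded:
  assumes "primitive_of v U" 
  obtains B where "\<And>x. x \<in> {a..b} \<Longrightarrow> \<bar>U x\<bar> \<le> B"
proof -
  have v: "loc_int v" using assms by (simp add: primitive_of_def)
  have "\<bar>U x\<bar> \<le> \<bar>U a\<bar> + (LINT s|lborel. \<bar>indicator {a..b} s * v s\<bar>)" if x: "x \<in> {a..b}" for x
  proof -
    have "U x - U a = (LINT s|lborel. indicator {a<..x} s * v s)"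
      using assms x by (auto simp: primitive_of_def)
    also have "\<bar>\<dots>\<bar> \<le> (LINT s|lborel. \<bar>indicator {a..b} s * v s\<bar>)"
      using v x loc_int_Ioc[OF v]
      by (intro order_trans[OF integral_abs_bound] integral_mono)
         (auto simp: loc_int_def indicator_def)
    finally show ?thesis by linarith
  qed
  thus ?thesis using that by blast
qed

text \<open>The fundamental theorem of calculus; it brings test functions under the product rule for
  primitives.\<close>

lemma primitive_of_C1:
  assumes "\<And>x. (U has_real_derivative v x) (at x)" "continuous_on UNIV v"
  shows "primitive_of v U"
  unfolding primitive_of_def
proof (intro conjI allI impI)
  have [measurable]: "v \<in> borel_measurable borel" using assms(2) borel_measurable_continuous_onI by blast
  have "integrable lborel (\<lambda>x. indicator {a..b} x * (1 * v x))" for a b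
  proof -
    obtain B where "\<And>x. x \<in> {a..b} \<Longrightarrow> \<bar>v x\<bar> \<le> B" using continuous_bounded_Icc[OF assms(2)] by blast
    thus ?thesis by (intro loc_int_mult_bounded loc_int_const) auto
  qed
  thus "loc_int v" by (auto simp: loc_int_def)
  fix a b :: real assume "a \<le> b"
  have "(LINT x|lborel. v x * indicator {a..b} x) = U b - U a"
    using assms \<open>a \<le> b\<close> by (intro integral_FTC_Icc_real) (auto simp: continuous_on_eq_continuous_at)
  moreover have "(LINT x|lborel. v x * indicator {a..b} x) = (LINT x|lborel. indicator {a<..b} x * v x)"
  proof (rule integral_cong_AE)
    have "AE x in lborel. x \<noteq> a" by (rule AE_lborel_singleton)
    thus "AE x in lborel. v x * indicator {a..b} x = indicator {a<..b} x * v x"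
      by (rule AE_mp) (auto simp: indicator_def)
  qed measurable
  ultimately show "U b - U a = (LINT x|lborel. indicator {a<..b} x * v x)" by simp
qed

lemma integrable_tensor:
  fixes f g :: "real \<Rightarrow> real"
  assumes f: "integrable lborel f" and g: "integrable lborel g"
  shows "integrable (lborel \<Otimes>\<^sub>M lborel) (\<lambda>(x, y). f x * g y)"
proof (rule lborel_pair.Fubini_integrable)
  have [measurable]: "f \<in> borel_measurable borel" "g \<in> borel_measurable borel" using f g by auto
  show "(\<lambda>(x, y). f x * g y) \<in> borel_measurable (lborel \<Otimes>\<^sub>M lborel)" by measurable
  show "integrable lborel (\<lambda>x. LINT y|lborel. norm (case (x, y) of (x, y) \<Rightarrow> f x * g y))"
    using f g by (simp add: abs_mult)
  show "AE x in lborel. integrable lborel (\<lambda>y. case (x, y) of (x, y) \<Rightarrow> f x * g y)"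
    using f g by simp
qed

text \<open>Splitting the square along its diagonal and exchanging the order of integration on one triangle.\<close>
lemma integral_triangles:
  fixes f g :: "real \<Rightarrow> real"
  assumes f: "integrable lborel f" and g: "integrable lborel g"
  shows "(LINT x|lborel. f x * (LINT s|lborel. of_bool (s \<le> x) * g s))
    + (LINT s|lborel. g s * (LINT x|lborel. of_bool (x \<le> s) * f x)) = (LINT x|lborel. f x) * (LINT s|lborel. g s)"
    and "integrable lborel (\<lambda>x. f x * (LINT s|lborel. of_bool (s \<le> x) * g s))"
proof -
  have [measurable]: "f \<in> borel_measurable borel" "g \<in> borel_measurable borel" using f g by auto
  have i: "integrable (lborel \<Otimes>\<^sub>M lborel) (\<lambda>(x, s). f x * (of_bool (s \<le> x) * g s))"
    by (rule Bochner_Integration.integrable_bound[OF integrable_tensor[OF f g]]) (auto simp: abs_mult)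
  have i': "integrable (lborel \<Otimes>\<^sub>M lborel) (\<lambda>(x, s). f x * (of_bool (x < s) * g s))"
    by (rule Bochner_Integration.integrable_bound[OF integrable_tensor[OF f g]]) (auto simp: abs_mult)
  show ii: "integrable lborel (\<lambda>x. f x * (LINT s|lborel. of_bool (s \<le> x) * g s))"
    using lborel_pair.integrable_fst[OF i] by simp
  have ii': "integrable lborel (\<lambda>x. f x * (LINT s|lborel. of_bool (x < s) * g s))"
    using lborel_pair.integrable_fst[OF i'] by simp
  have "(LINT s|lborel. g s * (LINT x|lborel. of_bool (x \<le> s) * f x))
     = (LINT s|lborel. LINT x|lborel. f x * (of_bool (x < s) * g s))"
  proof (intro Bochner_Integration.integral_cong refl)
    fix s :: real
    \<comment> \<open>Dropping the diagonal costs a null set and makes the two triangles disjoint,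
      so that together they fill the square exactly once.\<close>
    have "(LINT x|lborel. of_bool (x \<le> s) * f x) = (LINT x|lborel. of_bool (x < s) * f x)"
    proof (rule integral_cong_AE)
      have "AE x in lborel. x \<noteq> s" by (rule AE_lborel_singleton)
      thus "AE x in lborel. of_bool (x \<le> s) * f x = of_bool (x < s) * f x"
        by (rule AE_mp) auto
    qed measurable
    hence "g s * (LINT x|lborel. of_bool (x \<le> s) * f x) = (LINT x|lborel. g s * (of_bool (x < s) * f x))"
      by simp
    thus "g s * (LINT x|lborel. of_bool (x \<le> s) * f x) = (LINT x|lborel. f x * (of_bool (x < s) * g s))"
      by (simp add: mult_ac)
  qed
  also have "\<dots> = (LINT x|lborel. f x * (LINT s|lborel. of_bool (x < s) * g s))"
    using lborel_pair.Fubini_integral[OF i'] by simp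
  finally have "(LINT x|lborel. f x * (LINT s|lborel. of_bool (s \<le> x) * g s))
    + (LINT s|lborel. g s * (LINT x|lborel. of_bool (x \<le> s) * f x)) = 
    (LINT x|lborel. f x * (LINT s|lborel. of_bool (s \<le> x) * g s) + f x * (LINT s|lborel. of_bool (x < s) * g s))"
    using ii ii' by simp
  also have "\<dots> = (LINT x|lborel. f x * (LINT s|lborel. g s))"
  proof (intro Bochner_Integration.integral_cong refl)
    fix x
    have "integrable lborel (\<lambda>s. of_bool (s \<le> x) * g s)" "integrable lborel (\<lambda>s. of_bool (x < s) * g s)"
      by (rule Bochner_Integration.integrable_bound[OF g]; auto simp: abs_mult)+
    hence "(LINT s|lborel. of_bool (s \<le> x) * g s) + (LINT s|lborel. of_bool (x < s) * g s)
      = (LINT s|lborel. of_bool (s \<le> x) * g s + of_bool (x < s) * g s)"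
      by simp
    also have "\<dots> = (LINT s|lborel. g s)" by (intro Bochner_Integration.integral_cong) auto
    finally show "f x * (LINT s|lborel. of_bool (s \<le> x) * g s) + f x * (LINT s|lborel. of_bool (x < s) * g s)
      = f x * (LINT s|lborel. g s)" by (simp add: distrib_left[symmetric])
  qed
  finally show "(LINT x|lborel. f x * (LINT s|lborel. of_bool (s \<le> x) * g s))
    + (LINT s|lborel. g s * (LINT x|lborel. of_bool (x \<le> s) * f x)) = (LINT x|lborel. f x) * (LINT s|lborel. g s)"
    by simp
qed

text \<open>Integration by parts for absolutely continuous functions, obtained from Fubini on
  triangles instead of pointwise differentiation.\<close>

lemma primitive_of_mult:
  assumes U: "primitive_of u U" and V: "primitive_of v V"
  shows "primitive_of (\<lambda>x. v x * U x + u x * V x) (\<lambda>x. U x * V x)"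
  unfolding primitive_of_def
proof (intro conjI allI impI)
  have u: "loc_int u" and v: "loc_int v" using U V by (auto simp: primitive_of_def)
  have [measurable]: "U \<in> borel_measurable borel" "V \<in> borel_measurable borel" 
    "u \<in> borel_measurable borel" "v \<in> borel_measurable borel"
    using U V primitive_of_measurable u v loc_int_measurable by auto
  show "loc_int (\<lambda>x. v x * U x + u x * V x)"
    unfolding loc_int_def
  proof (intro conjI allI)
    fix a b :: real
    obtain B where "\<And>x. x \<in> {a..b} \<Longrightarrow> \<bar>U x\<bar> \<le> B" using primitive_of_bounded[OF U] by blast
    hence "integrable lborel (\<lambda>x. indicator {a..b} x * (v x * U x))"
      by (intro loc_int_mult_bounded[OF v]) auto
    moreover obtain B' where "\<And>x. x \<in> {a..b} \<Longrightarrow> \<bar>V x\<bar> \<le> B'" using primitive_of_bounded[OF V] by blast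
    hence "integrable lborel (\<lambda>x. indicator {a..b} x * (u x * V x))"
      by (intro loc_int_mult_bounded[OF u]) auto
    ultimately show "integrable lborel (\<lambda>x. indicator {a..b} x * (v x * U x + u x * V x))"
      by (simp add: distrib_left)
  qed measurable
  fix a b :: real assume "a \<le> b"
  \<comment> \<open>Cutting both densities off to (a, b] makes them integrable on the line, as
    \<open>integral_triangles\<close> demands.\<close>
  define u1 where "u1 x = indicator {a<..b} x * u x" for x
  define v1 where "v1 x = indicator {a<..b} x * v x" for x
  have i: "integrable lborel u1" "integrable lborel v1"
    unfolding u1_def v1_def by (intro loc_int_Ioc u v)+
  have U': "indicator {a<..b} x * (v x * U x) = v1 x * U a + v1 x * (LINT s|lborel. of_bool (s \<le> x) * u1 s)" for x
  proof (cases "x \<in> {a<..b}")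
    case True
    hence "U x = U a + (LINT s|lborel. indicator {a<..x} s * u s)"
      using primitive_ofD[OF U, of a x] by simp
    also have "(LINT s|lborel. indicator {a<..x} s * u s) = (LINT s|lborel. of_bool (s \<le> x) * u1 s)"
      using True by (intro Bochner_Integration.integral_cong) (auto simp: u1_def indicator_def)
    finally show ?thesis using True by (simp add: v1_def algebra_simps)
  qed (simp add: v1_def)
  have V': "indicator {a<..b} x * (u x * V x) = u1 x * V a + u1 x * (LINT s|lborel. of_bool (s \<le> x) * v1 s)" for x
  proof (cases "x \<in> {a<..b}")
    case True
    hence "V x = V a + (LINT s|lborel. indicator {a<..x} s * v s)"
      using primitive_ofD[OF V, of a x] by simp
    also have "(LINT s|lborel. indicator {a<..x} s * v s) = (LINT s|lborel. of_bool (s \<le> x) * v1 s)"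
      using True by (intro Bochner_Integration.integral_cong) (auto simp: v1_def indicator_def)
    finally show ?thesis using True by (simp add: u1_def algebra_simps)
  qed (simp add: u1_def)
  have Ub: "(LINT s|lborel. u1 s) = U b - U a" and Vb: "(LINT s|lborel. v1 s) = V b - V a"
    using U V \<open>a \<le> b\<close> by (auto simp: primitive_of_def u1_def v1_def)
  have "(LINT x|lborel. indicator {a<..b} x * (v x * U x + u x * V x))
    = (LINT x|lborel. (v1 x * U a + v1 x * (LINT s|lborel. of_bool (s \<le> x) * u1 s))
      + (u1 x * V a + u1 x * (LINT s|lborel. of_bool (s \<le> x) * v1 s)))"
    by (simp only: distrib_left U' V')
  also have "\<dots> = (LINT x|lborel. v1 x) * U a + (LINT x|lborel. u1 x) * V a +
     ((LINT x|lborel. v1 x * (LINT s|lborel. of_bool (s \<le> x) * u1 s))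
      + (LINT x|lborel. u1 x * (LINT s|lborel. of_bool (s \<le> x) * v1 s)))"
    using i integral_triangles(2)[OF i(1) i(2)] integral_triangles(2)[OF i(2) i(1)] by simp
  \<comment> \<open>The two triangle integrals add up to the product of the increments of
    \<open>U\<close> and \<open>V\<close>.\<close>
  also have "\<dots> = (V b - V a) * U a + (U b - U a) * V a + (V b - V a) * (U b - U a)"
    using integral_triangles(1)[OF i(2) i(1)] by (simp add: Ub Vb)
  also have "\<dots> = U b * V b - U a * V a" by (simp add: algebra_simps)
  finally show "U b * V b - U a * V a = (LINT x|lborel. indicator {a<..b} x * (v x * U x + u x * V x))" by simp
qed

section \<open>Sobolev functions\<close>

lemma integrable_indicator_Icc:
  fixes a b :: real
  shows "integrable lborel (\<lambda>x. indicator {a..b} x :: real)"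
  by (intro integrable_real_indicator) (auto simp: emeasure_lborel_Icc_eq)

lemma L2_measurable: "L2 u \<Longrightarrow> u \<in> borel_measurable borel"
  by (simp add: L2_def)

lemma L2_mult:
  assumes "L2 u" "L2 v" shows "integrable lborel (\<lambda>x. u x * v x)"
proof (rule Bochner_Integration.integrable_bound)
  show "integrable lborel (\<lambda>x. (u x)^2 + (v x)^2)" using assms by (simp add: L2_def)
  show "(\<lambda>x. u x * v x) \<in> borel_measurable lborel" using assms by (auto simp: L2_def)
  have "\<bar>r * s\<bar> \<le> r^2 + s^2" for r s :: real
  proof -
    have "2 * (\<bar>r\<bar> * \<bar>s\<bar>) \<le> r^2 + s^2" using sum_squares_bound[of "\<bar>r\<bar>" "\<bar>s\<bar>"] by (simp add: mult.assoc)
    moreover have "0 \<le> \<bar>r\<bar> * \<bar>s\<bar>" by simp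
    ultimately show ?thesis unfolding abs_mult by linarith
  qed
  thus "AE x in lborel. norm (u x * v x) \<le> norm ((u x)^2 + (v x)^2)"
    by (intro AE_I2) (simp add: order_trans[OF _ abs_ge_self])
qed

lemma L2_loc_int:
  assumes "L2 v" shows "loc_int v"
  unfolding loc_int_def
proof (intro conjI allI)
  show [measurable]: "v \<in> borel_measurable borel" using assms by (simp add: L2_def)
  fix a b :: real
  have "L2 (indicator {a..b})"
    using integrable_indicator_Icc[of a b] unfolding L2_def power2_eq_square indicator_inter_arith[symmetric] by simp
  thus "integrable lborel (\<lambda>x. indicator {a..b} x * v x)" using assms by (rule L2_mult)
qed

lemma L2_scale: "L2 u \<Longrightarrow> L2 (\<lambda>x. t * u x)"
  by (auto simp: L2_def power_mult_distrib)

lemma L2_add: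
  assumes "L2 u" "L2 v" shows "L2 (\<lambda>x. u x + v x)"
proof -
  have "integrable lborel (\<lambda>x. u x * u x + 2 * (u x * v x) + v x * v x)"
    using assms by (intro Bochner_Integration.integrable_add integrable_mult_right L2_mult)
  thus ?thesis using assms by (auto simp: L2_def power2_eq_square algebra_simps)
qed

section \<open>Weak derivatives and the chosen representative \<open>wd\<close>\<close>

lemma weak_deriv_unique:
  assumes "L2 v" "L2 w" "weak_deriv u v" "weak_deriv u w"
  shows "AE x in lborel. v x = w x"
proof -
  have "AE x in lborel. v x - w x = 0"
  proof (rule fundamental_lemma)
    show "loc_int (\<lambda>x. v x - w x)" using assms by (intro loc_int_diff L2_loc_int)
    fix g assume g: "test_fun g"
    hence "(LINT x|lborel. v x * g x) = (LINT x|lborel. w x * g x)"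
      using assms(3)[unfolded weak_deriv_def, rule_format, OF g]
        assms(4)[unfolded weak_deriv_def, rule_format, OF g] by linarith
    thus "(LINT x|lborel. (v x - w x) * g x) = 0"
      using loc_int_mult_test[OF L2_loc_int g] assms(1,2) by (simp add: left_diff_distrib)
  qed
  thus ?thesis by simp
qed

lemma weak_deriv_scale: 
  assumes "weak_deriv u v" shows "weak_deriv (\<lambda>x. t * u x) (\<lambda>x. t * v x)"
  using assms by (simp add: weak_deriv_def mult.assoc)

lemma weak_deriv_cong_AE:
  assumes "weak_deriv u v" "AE x in lborel. u x = u' x"
    "u \<in> borel_measurable borel" "u' \<in> borel_measurable borel"
  shows "weak_deriv u' v"
  unfolding weak_deriv_def
proof (intro allI impI)
  fix g assume g: "test_fun g"
  have [measurable]: "deriv g \<in> borel_measurable borel"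
    using g smooth_measurable smooth_deriv test_fun_smooth by blast
  have "(LINT x|lborel. u' x * deriv g x) = (LINT x|lborel. u x * deriv g x)"
    using assms by (intro integral_cong_AE) auto
  thus "(LINT x|lborel. u' x * deriv g x) = - (LINT x|lborel. v x * g x)"
    using assms(1) g by (simp add: weak_deriv_def)
qed

text \<open>As soon as one \<open>L2\<close> weak derivative exists, the choice behind
  \<open>wd\<close> yields a genuine one, and uniqueness identifies the two up to a null
  set.\<close>

lemma wd_eqI:
  assumes "L2 v" "weak_deriv u v"
  shows "L2 (wd u)" "weak_deriv u (wd u)" "AE x in lborel. wd u x = v x"
proof -
  have "L2 (wd u) \<and> weak_deriv u (wd u)"
    unfolding wd_def by (rule someI[of _ v]) (use assms in blast)
  thus "L2 (wd u)" "weak_deriv u (wd u)" by auto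
  thus "AE x in lborel. wd u x = v x" using weak_deriv_unique assms by blast
qed

text \<open>Given derivatives \<open>v\<close> and \<open>w\<close> must be matched with the
  \<open>wd\<close> of the functionals. At second order \<open>wd\<close> acts on
  \<open>wd u\<close> instead of \<open>v\<close>, and almost everywhere equality carries
  \<open>w\<close> over as a weak derivative of \<open>wd u\<close>.\<close>

lemma H2I:
  assumes "L2 u" "L2 v" "weak_deriv u v" "L2 w" "weak_deriv v w"
  shows "H2 u" "AE x in lborel. wd u x = v x" "AE x in lborel. wd (wd u) x = w x"
proof -
  show "H2 u" using assms by (auto simp: H2_def)
  show eq: "AE x in lborel. wd u x = v x" using assms wd_eqI by blast
  have "weak_deriv (wd u) w"
    by (rule weak_deriv_cong_AE[OF assms(5)]) (use eq wd_eqI[OF assms(2,3)] L2_measurable assms in auto)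
  thus "AE x in lborel. wd (wd u) x = w x" using assms(4) wd_eqI by blast
qed

lemma H2D:
  assumes "H2 u"
  shows "L2 u" "L2 (wd u)" "weak_deriv u (wd u)" "L2 (wd (wd u))" "weak_deriv (wd u) (wd (wd u))"
proof -
  obtain v w where vw: "L2 u" "L2 v" "weak_deriv u v" "L2 w" "weak_deriv v w"
    using assms by (auto simp: H2_def)
  show "L2 u" by fact
  show 1: "L2 (wd u)" "weak_deriv u (wd u)" using wd_eqI[OF vw(2,3)] by auto
  have "weak_deriv (wd u) w"
    by (rule weak_deriv_cong_AE[OF vw(5)]) (use H2I(2)[OF vw] 1 L2_measurable vw in auto)
  thus "L2 (wd (wd u))" "weak_deriv (wd u) (wd (wd u))" using wd_eqI[OF vw(4)] by auto
qed

lemma H2_scale: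
  assumes "H2 u"
  shows "H2 (\<lambda>x. t * u x)" "AE x in lborel. wd (\<lambda>x. t * u x) x = t * wd u x"
    "AE x in lborel. wd (wd (\<lambda>x. t * u x)) x = t * wd (wd u) x"
  using H2I[OF L2_scale L2_scale weak_deriv_scale L2_scale weak_deriv_scale, OF H2D(1,2,3,4,5), OF assms assms assms assms assms, of t]
  by auto

section \<open>Primitives as representatives of weakly differentiable functions\<close>

lemma test_fun_primitive: 
  assumes "test_fun g" shows "primitive_of (deriv g) g"
  using assms smooth_has_deriv smooth_continuous_on smooth_deriv 
  unfolding test_fun_smooth by (intro primitive_of_C1) blast+

text \<open>Primitives are bounded on bounded intervals. The case of constant \<open>u = 1\<close>
  makes a primitive itself locally integrable.\<close>

lemma loc_int_mult_primitive:
  assumes u: "loc_int u" and V: "primitive_of v V"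
  shows "loc_int (\<lambda>x. u x * V x)"
  unfolding loc_int_def
proof (intro conjI allI)
  have [measurable]: "V \<in> borel_measurable borel" "u \<in> borel_measurable borel"
    using assms primitive_of_measurable loc_int_measurable by auto
  show "(\<lambda>x. u x * V x) \<in> borel_measurable borel" by measurable
  fix a b :: real
  obtain B where "\<And>x. x \<in> {a..b} \<Longrightarrow> \<bar>V x\<bar> \<le> B" using primitive_of_bounded[OF V] by blast
  thus "integrable lborel (\<lambda>x. indicator {a..b} x * (u x * V x))"
    by (intro loc_int_mult_bounded[OF u]) auto
qed

text \<open>The product rule for \<open>U * g\<close>, integrated over an interval containing the
  supports of \<open>g\<close> and \<open>deriv g\<close>, has no boundary terms.\<close>

lemma weak_deriv_of_primitive:
  assumes U: "primitive_of v U" shows "weak_deriv U v"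
  unfolding weak_deriv_def
proof (intro allI impI)
  fix g assume g: "test_fun g"
  obtain R where R: "R > 0" "\<And>x. \<bar>x\<bar> \<ge> R \<Longrightarrow> g x = 0" using test_fun_support[OF g] by blast
  obtain R' where R': "R' > 0" "\<And>x. \<bar>x\<bar> \<ge> R' \<Longrightarrow> deriv g x = 0"
    using test_fun_support[OF test_fun_deriv[OF g]] by blast
  define S where "S = max R R'"
  have v: "loc_int v" using U by (simp add: primitive_of_def)
  have Ul: "loc_int U" using loc_int_mult_primitive[OF loc_int_const U, of 1] by simp
  have P: "primitive_of (\<lambda>x. deriv g x * U x + v x * g x) (\<lambda>x. U x * g x)"
    by (rule primitive_of_mult[OF U test_fun_primitive[OF g]])
  have "(LINT x|lborel. indicator {-S<..S} x * (deriv g x * U x + v x * g x)) = U S * g S - U (-S) * g (-S)"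
    using primitive_ofD[OF P, of "-S" S] R by (simp add: S_def)
  also have "\<dots> = 0" using R by (simp add: S_def)
  also have "(LINT x|lborel. indicator {-S<..S} x * (deriv g x * U x + v x * g x))
     = (LINT x|lborel. U x * deriv g x + v x * g x)"
  proof (intro Bochner_Integration.integral_cong refl)
    fix x
    show "indicator {-S<..S} x * (deriv g x * U x + v x * g x) = U x * deriv g x + v x * g x"
    proof (cases "\<bar>x\<bar> \<ge> S")
      case True thus ?thesis using R(2)[of x] R'(2)[of x] by (simp add: S_def)
    qed (auto simp: indicator_def)
  qed
  also have "\<dots> = (LINT x|lborel. U x * deriv g x) + (LINT x|lborel. v x * g x)"
    by (intro Bochner_Integration.integral_add loc_int_mult_test Ul v g test_fun_deriv)
  finally show "(LINT x|lborel. U x * deriv g x) = - (LINT x|lborel. v x * g x)" by simp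
qed

text \<open>Both \<open>u\<close> and \<open>prim v\<close> have weak derivative \<open>v\<close>,
  so their difference is almost everywhere a constant \<open>k\<close>; adding \<open>k\<close> to
  \<open>prim v\<close> gives the absolutely continuous representative.\<close>

lemma weak_deriv_representative:
  assumes u: "L2 u" and v: "L2 v" and uv: "weak_deriv u v"
  obtains U where "primitive_of v U" "AE x in lborel. u x = U x" "L2 U"
proof -
  have P: "primitive_of v (prim v)" by (intro primitive_of_prim L2_loc_int v)
  have Pl: "loc_int (prim v)" using loc_int_mult_primitive[OF loc_int_const P, of 1] by simp
  have "\<exists>k. AE x in lborel. u x - prim v x = k"
  proof (rule weak_deriv_zero_const)
    show "loc_int (\<lambda>x. u x - prim v x)" by (intro loc_int_diff L2_loc_int u Pl)
    fix g assume g: "test_fun g"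
    show "(LINT x|lborel. (u x - prim v x) * deriv g x) = 0"
      using uv weak_deriv_of_primitive[OF P] loc_int_mult_test[OF L2_loc_int[OF u] test_fun_deriv[OF g]]
         loc_int_mult_test[OF Pl test_fun_deriv[OF g]] g
      by (simp add: left_diff_distrib weak_deriv_def)
  qed
  then obtain k where k: "AE x in lborel. u x - prim v x = k" by blast
  define U where "U x = prim v x + k" for x
  have PU: "primitive_of v U" using P unfolding primitive_of_def U_def by simp
  moreover have eq: "AE x in lborel. u x = U x" using k by (rule AE_mp) (simp add: U_def)
  moreover have "L2 U"
  proof -
    have [measurable]: "U \<in> borel_measurable borel" "u \<in> borel_measurable borel"
      using primitive_of_measurable[OF PU] u L2_measurable by auto
    have "AE x in lborel. (u x)^2 = (U x)^2" using eq by (rule AE_mp) simp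
    hence "integrable lborel (\<lambda>x. (u x)^2) \<longleftrightarrow> integrable lborel (\<lambda>x. (U x)^2)"
      by (intro integrable_cong_AE) auto
    thus ?thesis using u by (simp add: L2_def)
  qed
  ultimately show ?thesis using that by blast
qed

section \<open>Integrable primitives at infinity and Sobolev estimates\<close>

lemma integrable_small_right:
  fixes H :: "real \<Rightarrow> real"
  assumes H: "integrable lborel H" and "e > 0"
  shows "\<exists>y\<ge>N. \<bar>H y\<bar> < e"
proof (rule ccontr)
  assume "\<not> ?thesis"
  hence big: "\<bar>H y\<bar> \<ge> e" if "y \<ge> N" for y using that by force
  \<comment> \<open>An interval of length \<open>n\<close> on which \<bar>H\<bar> is at least
    \<open>e\<close> would already exceed the whole integral of \<bar>H\<bar>.\<close>
  obtain n :: nat where n: "real n > (LINT x|lborel. \<bar>H x\<bar>) / e" using reals_Archimedean2 by blast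
  have "e * real n = (LINT x|lborel. e * indicator {N..N + real n} x)" by simp
  also have "\<dots> \<le> (LINT x|lborel. \<bar>H x\<bar>)"
    using H big by (intro integral_mono) (auto intro!: integrable_mult_right integrable_indicator_Icc simp: indicator_eq_0_iff split: split_indicator)
  finally show False using n \<open>e > 0\<close> by (simp add: field_simps)
qed

lemma integrable_small_left:
  fixes H :: "real \<Rightarrow> real"
  assumes H: "integrable lborel H" and "e > 0"
  shows "\<exists>y\<le>N. \<bar>H y\<bar> < e"
proof -
  have "integrable lborel (\<lambda>x. H (0 + (-1) * x))" using H by (rule lborel_integrable_real_affine) simp
  from integrable_small_right[OF this \<open>e > 0\<close>, of "-N"] obtain y where "y \<ge> -N" "\<bar>H (-y)\<bar> < e" by auto
  thus ?thesis by (intro exI[of _ "-y"]) auto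
qed

text \<open>Integrability of \<open>H\<close> provides points far to the left where \<open>H\<close>
  is arbitrarily small; the increment from there to \<open>x\<close> is at most the total mass of
  \<bar>k\<bar>.\<close>

lemma primitive_bound:
  assumes P: "primitive_of k H" and H: "integrable lborel H" and k: "integrable lborel k"
  shows "\<bar>H x\<bar> \<le> (LINT s|lborel. \<bar>k s\<bar>)"
proof (rule field_le_epsilon)
  fix e :: real assume "e > 0"
  then obtain y where y: "y \<le> x" "\<bar>H y\<bar> < e" using integrable_small_left[OF H] by blast
  have "H x - H y = (LINT s|lborel. indicator {y<..x} s * k s)" using P y by (simp add: primitive_of_def)
  also have "\<bar>\<dots>\<bar> \<le> (LINT s|lborel. \<bar>k s\<bar>)"
    using P k loc_int_Ioc[of k]
    by (intro order_trans[OF integral_abs_bound] integral_mono) (auto simp: indicator_def primitive_of_def)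
  finally show "\<bar>H x\<bar> \<le> (LINT s|lborel. \<bar>k s\<bar>) + e" using y by linarith
qed

text \<open>Integrals of \<open>k\<close> over growing intervals are increments of \<open>H\<close>.
  Choosing endpoints where \<open>H\<close> is small sends them to zero, so no limit of
  \<open>H\<close> at infinity has to be established.\<close>

lemma primitive_integral_zero:
  assumes P: "primitive_of k H" and H: "integrable lborel H" and k: "integrable lborel k"
  shows "(LINT s|lborel. k s) = 0"
proof -
  have "\<forall>n::nat. \<exists>y\<ge>real n. \<bar>H y\<bar> < 1 / real (Suc n)"
    using integrable_small_right[OF H] by simp
  then obtain b where b: "\<And>n. b n \<ge> real n" "\<And>n. \<bar>H (b n)\<bar> < 1 / real (Suc n)" by metis
  have "\<forall>n::nat. \<exists>y\<le>- real n. \<bar>H y\<bar> < 1 / real (Suc n)"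
    using integrable_small_left[OF H] by simp
  then obtain a where a: "\<And>n. a n \<le> - real n" "\<And>n. \<bar>H (a n)\<bar> < 1 / real (Suc n)" by metis
  have [measurable]: "k \<in> borel_measurable borel" using k by auto
  have "(\<lambda>n. LINT s|lborel. indicator {a n<..b n} s * k s) \<longlonglongrightarrow> (LINT s|lborel. k s)"
  proof (rule integral_dominated_convergence)
    show "integrable lborel (\<lambda>x. \<bar>k x\<bar>)" using k by simp
    show "AE x in lborel. (\<lambda>n. indicator {a n<..b n} x * k x) \<longlonglongrightarrow> k x"
    proof (intro AE_I2)
      fix x :: real
      obtain N :: nat where N: "\<bar>x\<bar> < real N" using reals_Archimedean2 by blast
      have "indicator {a n<..b n} x * k x = k x" if "n \<ge> N" for n
      proof -
        have "real N \<le> real n" using that by simp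
        hence "x \<in> {a n<..b n}" using a(1)[of n] b(1)[of n] N by auto
        thus ?thesis by simp
      qed
      thus "(\<lambda>n. indicator {a n<..b n} x * k x) \<longlonglongrightarrow> k x"
        by (intro tendsto_eventually eventually_sequentiallyI[of N])
    qed
    show "AE x in lborel. norm (indicator {a n<..b n} x * k x) \<le> \<bar>k x\<bar>" for n
      by (intro AE_I2) (auto simp: indicator_def)
  qed measurable
  moreover have "(\<lambda>n. LINT s|lborel. indicator {a n<..b n} s * k s) \<longlonglongrightarrow> 0"
  proof (rule Lim_null_comparison)
    have "norm (LINT s|lborel. indicator {a n<..b n} s * k s) \<le> 2 * (1 / real (Suc n))" for n
    proof -
      have "(LINT s|lborel. indicator {a n<..b n} s * k s) = H (b n) - H (a n)"
        using P a(1)[of n] b(1)[of n] by (simp add: primitive_of_def)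
      thus ?thesis using a(2)[of n] b(2)[of n] by simp
    qed
    thus "\<forall>\<^sub>F n in sequentially. norm (LINT s|lborel. indicator {a n<..b n} s * k s) \<le> 2 * (1 / real (Suc n))"
      by simp
    show "(\<lambda>n. 2 * (1 / real (Suc n))) \<longlonglongrightarrow> 0"
      using tendsto_mult[OF tendsto_const[of 2] LIMSEQ_Suc[OF lim_1_over_n]] by simp
  qed
  ultimately show ?thesis using LIMSEQ_unique by blast
qed

text \<open>The one-dimensional Sobolev embedding: U^2 is an integrable primitive of 2 v U, and 2
  \<bar>v U\<bar> is at most U^2 + v^2.\<close>

lemma H1_sup_bound:
  assumes "L2 u" "L2 v" "weak_deriv u v"
  shows "AE x in lborel. (u x)^2 \<le> (LINT x|lborel. (u x)^2) + (LINT x|lborel. (v x)^2)"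
proof -
  obtain U where U: "primitive_of v U" "AE x in lborel. u x = U x" "L2 U"
    using weak_deriv_representative[OF assms] by blast
  have vU: "integrable lborel (\<lambda>x. v x * U x)" by (intro L2_mult assms U)
  have eq: "(LINT x|lborel. (u x)^2) = (LINT x|lborel. (U x)^2)"
  proof (rule integral_cong_AE)
    show "AE x in lborel. (u x)^2 = (U x)^2" using U(2) by (rule AE_mp) simp
  qed (use assms U(3) L2_measurable in auto)
  have "(U x)^2 \<le> (LINT x|lborel. (u x)^2) + (LINT x|lborel. (v x)^2)" for x
  proof -
    have "\<bar>U x * U x\<bar> \<le> (LINT s|lborel. \<bar>v s * U s + v s * U s\<bar>)"
      using vU L2_mult[OF U(3) U(3)] by (intro primitive_bound[OF primitive_of_mult[OF U(1) U(1)]] Bochner_Integration.integrable_add)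
    also have "\<dots> \<le> (LINT s|lborel. (U s)^2 + (v s)^2)"
    proof (rule integral_mono)
      show "\<bar>v s * U s + v s * U s\<bar> \<le> (U s)^2 + (v s)^2" for s
        using sum_squares_bound[of "\<bar>U s\<bar>" "\<bar>v s\<bar>"] by (simp add: abs_mult mult_ac)
      show "integrable lborel (\<lambda>s. \<bar>v s * U s + v s * U s\<bar>)"
        by (intro integrable_abs Bochner_Integration.integrable_add vU)
    qed (use U(3) assms(2) in \<open>auto simp: L2_def\<close>)
    also have "\<dots> = (LINT x|lborel. (u x)^2) + (LINT x|lborel. (v x)^2)"
      using U assms eq by (simp add: L2_def)
    finally show ?thesis by (simp add: power2_eq_square)
  qed
  thus ?thesis using U(2) by auto
qed

text \<open>The product of the representatives of \<open>u\<close> and \<open>v\<close> is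
  integrable with an integrable density, whose integral is therefore zero.\<close>

lemma H2_integration_by_parts:
  assumes "L2 u" "L2 v" "L2 w" "weak_deriv u v" "weak_deriv v w"
  shows "(LINT x|lborel. (v x)^2) = - (LINT x|lborel. u x * w x)"
proof -
  obtain U where U: "primitive_of v U" "AE x in lborel. u x = U x" "L2 U"
    using weak_deriv_representative[OF assms(1,2,4)] by blast
  obtain V where V: "primitive_of w V" "AE x in lborel. v x = V x" "L2 V"
    using weak_deriv_representative[OF assms(2,3,5)] by blast
  have i: "integrable lborel (\<lambda>x. w x * U x)" "integrable lborel (\<lambda>x. v x * V x)"
    by (intro L2_mult assms U V)+
  have "(LINT x|lborel. w x * U x + v x * V x) = 0"
    using i by (intro primitive_integral_zero[OF primitive_of_mult[OF U(1) V(1)]] L2_mult U V) auto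
  moreover have "(LINT x|lborel. w x * U x) = (LINT x|lborel. u x * w x)"
    by (rule integral_cong_AE) (use U assms L2_measurable in \<open>auto simp: mult.commute\<close>)
  moreover have "(LINT x|lborel. v x * V x) = (LINT x|lborel. (v x)^2)"
  proof (rule integral_cong_AE)
    show "AE x in lborel. v x * V x = (v x)^2" using V(2) by (rule AE_mp) (simp add: power2_eq_square)
  qed (use V assms L2_measurable in auto)
  ultimately show ?thesis using i by simp
qed

section \<open>Scaling and coercivity of the quadratic functional I\<close>

lemma Ifun_expand:
  assumes "H2 u"
  shows "Ifun \<beta> c u = (LINT x|lborel. (wd (wd u) x)^2) - \<beta> * (LINT x|lborel. (wd u x)^2)
    + (1 - c^2) * (LINT x|lborel. (u x)^2)"
  using H2D[OF assms] unfolding Ifun_def L2_def by simp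

lemma Ifun_scale:
  assumes "H2 u"
  shows "Ifun \<beta> c (\<lambda>x. t * u x) = t^2 * Ifun \<beta> c u"
proof -
  note s = H2_scale[OF assms, of t]
  have [measurable]: "u \<in> borel_measurable borel" "wd u \<in> borel_measurable borel"
    "wd (wd u) \<in> borel_measurable borel" "wd (\<lambda>x. t * u x) \<in> borel_measurable borel"
    "wd (wd (\<lambda>x. t * u x)) \<in> borel_measurable borel"
    using L2_measurable H2D(1,2,4) assms s(1) by blast+
  have "Ifun \<beta> c (\<lambda>x. t * u x) = (LINT x|lborel. t^2 * ((wd (wd u) x)^2 - \<beta> * (wd u x)^2 + (1 - c^2) * (u x)^2))"
    unfolding Ifun_def
  proof (rule integral_cong_AE)
    show "AE x in lborel. (wd (wd (\<lambda>x. t * u x)) x)^2 - \<beta> * (wd (\<lambda>x. t * u x) x)^2 + (1 - c^2) * (t * u x)^2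
      = t^2 * ((wd (wd u) x)^2 - \<beta> * (wd u x)^2 + (1 - c^2) * (u x)^2)"
      using s(2,3) by eventually_elim (simp add: algebra_simps power_mult_distrib)
  qed measurable
  thus ?thesis by (simp add: Ifun_def)
qed

text \<open>Expanding the integral of (u'' + \<gamma> u)^2 \<ge> 0 by parts, with \<gamma> = sqrt(1
  - c^2), bounds 2 \<gamma> times the integral of u'^2 by that of u''^2 + \<gamma>^2 u^2. Strictness
  of \<beta> < 2 \<gamma> leaves a fixed fraction of the latter.\<close>

lemma Ifun_coercive:
  assumes c: "c^2 < 1" and \<beta>: "\<beta> < 2 * sqrt (1 - c^2)"
  obtains C where "C > 0" "\<And>u. H2 u \<Longrightarrow> (LINT x|lborel. (u x)^2) + (LINT x|lborel. (wd u x)^2) \<le> C * Ifun \<beta> c u"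
proof -
  define \<gamma> where "\<gamma> = sqrt (1 - c^2)"
  have g: "\<gamma> > 0" "\<gamma>^2 = 1 - c^2" using c by (auto simp: \<gamma>_def)
  \<comment> \<open>The fraction of \<open>S\<close> that the \<beta>-term can consume. The maximum
    with 0 covers negative \<beta> and keeps \<theta> nonnegative, as multiplying \<open>AB\<close>
    by it requires.\<close>
  define \<theta> where "\<theta> = max \<beta> 0 / (2 * \<gamma>)"
  have th: "0 \<le> \<theta>" "\<theta> < 1" "\<beta> \<le> \<theta> * (2 * \<gamma>)" using g \<beta> by (auto simp: \<theta>_def \<gamma>_def[symmetric])
  \<comment> \<open>Collects D \<le> S / \<gamma>^2, B \<le> S / (2 \<gamma>) and S \<le> I / (1 -
    \<theta>).\<close>
  define C where "C = (1 / \<gamma>^2 + 1 / (2 * \<gamma>)) / (1 - \<theta>)"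
  have "C > 0" unfolding C_def using g(1) th(2) by (intro divide_pos_pos add_pos_pos) auto
  moreover have "(LINT x|lborel. (u x)^2) + (LINT x|lborel. (wd u x)^2) \<le> C * Ifun \<beta> c u" if u: "H2 u" for u
  proof -
    note h = H2D[OF u]
    define A where "A = (LINT x|lborel. (wd (wd u) x)^2)"
    define B where "B = (LINT x|lborel. (wd u x)^2)"
    define D where "D = (LINT x|lborel. (u x)^2)"
    have nn: "B \<ge> 0" "D \<ge> 0" "A \<ge> 0" by (auto simp: B_def D_def A_def)
    have "0 \<le> (LINT x|lborel. (wd (wd u) x + \<gamma> * u x)^2)" by simp
    also have "\<dots> = (LINT x|lborel. (wd (wd u) x)^2 + (2 * \<gamma>) * (u x * wd (wd u) x) + \<gamma>^2 * (u x)^2)"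
      by (intro Bochner_Integration.integral_cong) (auto simp: power2_eq_square algebra_simps)
    also have "\<dots> = A + (2 * \<gamma>) * (LINT x|lborel. u x * wd (wd u) x) + \<gamma>^2 * D"
      using h L2_mult[OF h(1) h(4)] by (simp add: L2_def A_def D_def)
    finally have AB: "2 * \<gamma> * B \<le> A + \<gamma>^2 * D"
      using H2_integration_by_parts[OF h(1,2,4,3,5)] by (simp add: B_def algebra_simps)
    define S where "S = A + \<gamma>^2 * D"
    have "\<beta> * B \<le> \<theta> * (2 * \<gamma>) * B" using th nn by (intro mult_right_mono) auto
    also have "\<dots> \<le> \<theta> * S" using mult_left_mono[OF AB th(1)] by (simp add: S_def mult.assoc)
    finally have "(1 - \<theta>) * S \<le> Ifun \<beta> c u"
      unfolding Ifun_expand[OF u] A_def[symmetric] B_def[symmetric] D_def[symmetric] g(2)[symmetric]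
      by (simp add: S_def algebra_simps)
    hence SI: "S \<le> Ifun \<beta> c u / (1 - \<theta>)" using th by (simp add: field_simps)
    have "D \<le> S / \<gamma>^2" using g nn by (simp add: S_def field_simps)
    moreover have "B \<le> S / (2 * \<gamma>)" using g AB by (simp add: S_def field_simps)
    ultimately have "D + B \<le> (1 / \<gamma>^2 + 1 / (2 * \<gamma>)) * S" by (simp add: distrib_right)
    also have "\<dots> \<le> (1 / \<gamma>^2 + 1 / (2 * \<gamma>)) * (Ifun \<beta> c u / (1 - \<theta>))"
      using g(1) SI by (intro mult_left_mono) auto
    finally show ?thesis by (simp add: B_def D_def C_def)
  qed
  ultimately show ?thesis using that by blast
qed

lemma test_fun_L2:
  assumes "test_fun g" shows "L2 g"
proof -
  have "loc_int g" using loc_int_mult_primitive[OF loc_int_const test_fun_primitive[OF assms], of 1] by simp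
  thus ?thesis using loc_int_mult_test[OF _ assms, of g] by (simp add: L2_def loc_int_def power2_eq_square)
qed

lemma test_fun_H2:
  assumes "test_fun g" shows "H2 g"
  by (rule H2I(1)[of _ "deriv g" "deriv (deriv g)"])
    (intro test_fun_L2 test_fun_deriv weak_deriv_of_primitive test_fun_primitive assms)+

section \<open>The variational characterization\<close>

text \<open>Differentiating the homogeneity relation at t = 1 gives Euler's identity s f'(s) = p
  f(s), which makes s f(s) / (p + 1) an antiderivative of \<open>f\<close> vanishing at 0.\<close>

lemma Fprim_homogeneous:
  fixes f :: "real \<Rightarrow> real" and p :: real
  assumes p: "p > 1" and f': "\<And>s. (f has_real_derivative f' s) (at s)"
    and hom: "\<And>t s. t > 0 \<Longrightarrow> f (t * s) = t powr p * f s"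
  shows "(p + 1) * Fprim f s = s * f s"
proof -
  have euler: "s * f' s = p * f s" for s
  proof -
    have "((\<lambda>t. f (t * s)) has_real_derivative f' (1 * s) * s) (at 1)"
      by (rule DERIV_chain2[OF f']) (auto intro!: derivative_eq_intros)
    moreover have "((\<lambda>t. t powr p * f s) has_real_derivative p * f s) (at 1)"
      by (auto intro!: derivative_eq_intros)
    moreover have "eventually (\<lambda>t. t powr p * f s = f (t * s)) (nhds (1::real))"
      using hom by (intro eventually_mono[OF eventually_nhds_in_open[of "{0<..}"]]) auto
    ultimately show ?thesis
      using DERIV_unique[OF _ DERIV_eventually_eq] by (metis mult.commute mult_1)
  qed
  have cont: "continuous_on A f" for A
    using f' DERIV_isCont continuous_at_imp_continuous_on by blast
  define G where "G s = s * f s / (p + 1)" for s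
  have G': "(G has_real_derivative f s) (at s)" for s
  proof -
    have "(G has_real_derivative (f s + s * f' s) / (p + 1)) (at s)"
      unfolding G_def using f'[of s] p by (auto intro!: derivative_eq_intros)
    also have "(f s + s * f' s) / (p + 1) = f s" using p by (simp add: euler field_simps)
    finally show ?thesis .
  qed
  have "(LBINT t=ereal 0..ereal s. f t) = G s - G 0"
    by (rule interval_integral_FTC_finite[OF cont])
       (use G' in \<open>auto simp: has_real_derivative_iff_has_vector_derivative intro: has_vector_derivative_at_within\<close>)
  thus ?thesis using p by (simp add: Fprim_def G_def zero_ereal_def)
qed

section \<open>The nonlinear functional K: scaling, growth and integrability\<close>

locale homogeneous_nonlinearity =
  fixes f :: "real \<Rightarrow> real" and p :: real
  assumes p: "p > 1" and cont: "continuous_on UNIV f"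
    and hom: "\<And>t s. t > 0 \<Longrightarrow> f (t * s) = t powr p * f s"
    and Fprim_eq: "\<And>s. (p + 1) * Fprim f s = s * f s"
begin

lemma measurable_f [measurable]: "f \<in> borel_measurable borel"
  using cont borel_measurable_continuous_onI by blast

lemma Fprim_altdef: "Fprim f s = s * f s / (p + 1)"
  using Fprim_eq[of s] p by (simp add: field_simps)

lemma Kfun_altdef: "Kfun f p u = (LINT x|lborel. u x * f (u x))"
  using p unfolding Kfun_def Fprim_altdef by simp

lemma Kfun_scale:
  assumes "t > 0" shows "Kfun f p (\<lambda>x. t * u x) = t powr (p + 1) * Kfun f p u"
proof -
  have "Kfun f p (\<lambda>x. t * u x) = (LINT x|lborel. t powr (p + 1) * (u x * f (u x)))"
    unfolding Kfun_altdef using assms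
    by (intro Bochner_Integration.integral_cong) (auto simp: hom powr_add)
  thus ?thesis by (simp add: Kfun_altdef)
qed

text \<open>Dominates \<bar>f 1\<bar> and \<bar>f (-1)\<bar>, the two values that determine
  \<open>f\<close> away from 0; the summand 1 keeps it positive, so it can appear in a
  denominator.\<close>

definition growth :: real where "growth = \<bar>f 1\<bar> + \<bar>f (-1)\<bar> + 1"

lemma growth_pos: "growth > 0" by (simp add: growth_def add_nonneg_pos)

text \<open>Homogeneity reduces each sign of \<open>s\<close> to \<open>f 1\<close> or
  \<open>f (-1)\<close>. The right-hand side is a multiple of \<bar>s\<bar>^(p+1), split so that a
  bound on u^2 can be inserted in one factor while the other is integrated.\<close>

lemma growth_bound: "\<bar>s * f s\<bar> \<le> growth * (s^2 * (s^2) powr ((p - 1) / 2))"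
proof -
  have *: "\<bar>r * (r powr p * y)\<bar> \<le> growth * (r^2 * (r^2) powr ((p - 1) / 2))" if "r > 0" "\<bar>y\<bar> \<le> growth" for r y
  proof -
    have "(r^2) powr ((p - 1) / 2) = (r powr 2) powr ((p - 1) / 2)" using that by (simp add: powr_numeral)
    also have "\<dots> = r powr (p - 1)"
    proof -
      have "2 * ((p - 1) / 2) = p - 1" by (simp add: field_simps)
      thus ?thesis by (simp only: powr_powr)
    qed
    finally have "r^2 * (r^2) powr ((p - 1) / 2) = r * r powr p"
      using that by (simp add: powr_diff power2_eq_square)
    thus ?thesis using that mult_right_mono[OF that(2), of "r * r powr p"] by (simp add: abs_mult mult_ac)
  qed
  consider "s > 0" | "s < 0" | "s = 0" by linarith
  thus ?thesis
  proof cases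
    case 1 thus ?thesis using *[of s "f 1"] hom[of s 1] by (simp add: growth_def)
  next
    case 2 thus ?thesis using *[of "-s" "f (-1)"] hom[of "-s" "-1"] by (simp add: growth_def)
  qed simp
qed

lemma Kfun_bound:
  assumes u: "L2 u" and sup: "AE x in lborel. (u x)^2 \<le> N" and D: "(LINT x|lborel. (u x)^2) \<le> N"
  shows "integrable lborel (\<lambda>x. u x * f (u x))" "Kfun f p u \<le> growth * N powr ((p + 1) / 2)"
proof -
  have [measurable]: "u \<in> borel_measurable borel" using u L2_measurable by blast
  define a where "a = growth * N powr ((p - 1) / 2)"
  have a: "a \<ge> 0" using growth_pos by (simp add: a_def)
  have N: "N \<ge> 0" by (rule order_trans[OF _ D]) simp
  have iu: "integrable lborel (\<lambda>x. a * (u x)^2)" using u by (simp add: L2_def)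
  have le: "AE x in lborel. \<bar>u x * f (u x)\<bar> \<le> a * (u x)^2"
    using sup
  proof eventually_elim
    case (elim x)
    have "((u x)^2) powr ((p - 1) / 2) \<le> N powr ((p - 1) / 2)"
      using elim p by (intro powr_mono2) auto
    hence "growth * ((u x)^2 * ((u x)^2) powr ((p - 1) / 2)) \<le> growth * ((u x)^2 * N powr ((p - 1) / 2))"
      using growth_pos by (intro mult_left_mono) auto
    thus ?case using growth_bound[of "u x"] by (simp add: a_def mult_ac)
  qed
  show i: "integrable lborel (\<lambda>x. u x * f (u x))"
    by (rule Bochner_Integration.integrable_bound[OF iu]) (use le a in auto)
  have "Kfun f p u \<le> (LINT x|lborel. a * (u x)^2)"
    unfolding Kfun_altdef
  proof (rule integral_mono_AE[OF i iu])
    show "AE x in lborel. u x * f (u x) \<le> a * (u x)^2" using le by eventually_elim simp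
  qed
  also have "\<dots> \<le> a * N" using D a by (simp add: mult_left_mono)
  also have "\<dots> = growth * N powr ((p + 1) / 2)"
  proof (cases "N = 0")
    case False
    have "(p + 1) / 2 = (p - 1) / 2 + 1" by (simp add: field_simps)
    hence "N powr ((p + 1) / 2) = N powr ((p - 1) / 2) * N powr 1" by (simp only: powr_add)
    thus ?thesis using N by (simp add: a_def)
  qed (simp add: a_def)
  finally show "Kfun f p u \<le> growth * N powr ((p + 1) / 2)" .
qed

lemma H2_Kfun_integrable:
  assumes "H2 u" shows "integrable lborel (\<lambda>x. u x * f (u x))"
  by (rule Kfun_bound(1)[OF H2D(1)[OF assms] H1_sup_bound[OF H2D(1-3), OF assms assms assms]]) simp

lemma Kfun_zero:
  assumes "AE x in lborel. u x = 0" shows "Kfun f p u = 0"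
proof -
  have "(LINT x|lborel. u x * f (u x)) = 0"
    by (rule integral_eq_zero_AE) (use assms in eventually_elim, simp)
  thus ?thesis by (simp add: Kfun_altdef)
qed

text \<open>Where the bump is positive, \<open>s * b x\<close> is a positive multiple of
  \<open>s\<close>, so homogeneity gives the integrand the sign of \<open>s * f s\<close>.\<close>

lemma Kfun_pos_exists:
  assumes "Fprim f s > 0" obtains u where "H2 u" "Kfun f p u > 0"
proof -
  define b where "b = bump 0 1 0"
  have H: "H2 (\<lambda>x. s * b x)" unfolding b_def by (intro H2_scale test_fun_H2 test_fun_bump)
  have s: "s * f s > 0" using assms p by (simp add: Fprim_altdef zero_less_divide_iff)
  have pos: "(s * b x) * f (s * b x) > 0" if "b x > 0" for x
  proof -
    have "f (s * b x) = b x powr p * f s" using hom[OF that, of s] by (simp add: mult.commute)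
    hence "(s * b x) * f (s * b x) = (b x * b x powr p) * (s * f s)" by simp
    also have "\<dots> > 0" using that by (intro mult_pos_pos[OF _ s]) simp
    finally show ?thesis .
  qed
  have "(LINT x|lborel. (s * b x) * f (s * b x)) > 0"
  proof (rule integral_pos_on_interval[OF H2_Kfun_integrable[OF H], of 0 1])
    show "(s * b x) * f (s * b x) \<ge> 0" for x
      using pos[of x] bump_nonneg[of 0 1 0 x] by (cases "b x = 0") (auto simp: b_def less_le)
    show "(s * b x) * f (s * b x) > 0" if "x \<in> {0<..<1}" for x
      using pos bump_pos[OF that] by (simp add: b_def)
  qed simp
  thus ?thesis using that[OF H] by (simp add: Kfun_altdef)
qed

lemma Lfun_expand:
  assumes "inX w"
  shows "Lfun f \<beta> c w = (Ifun \<beta> c (fst w) + (LINT x|lborel. (c * fst w x + snd w x)^2)) / 2 - Kfun f p (fst w) / (p + 1)"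
proof -
  obtain u v where w: "w = (u, v)" by (cases w)
  have u: "H2 u" and v: "L2 v" using assms by (auto simp: inX_def w)
  note h = H2D[OF u]
  have K: "integrable lborel (\<lambda>x. Fprim f (u x))"
    unfolding Fprim_altdef using H2_Kfun_integrable[OF u] by simp
  have uv: "integrable lborel (\<lambda>x. u x * v x)" by (rule L2_mult[OF h(1) v])
  have i: "integrable lborel (\<lambda>x. (u x)^2)" "integrable lborel (\<lambda>x. (v x)^2)"
    "integrable lborel (\<lambda>x. (wd u x)^2)" "integrable lborel (\<lambda>x. (wd (wd u) x)^2)"
    using h v by (auto simp: L2_def)
  \<comment> \<open>Completes the square: u^2 + v^2 + 2 c u v = (1 - c^2) u^2 + (c u + v)^2.\<close>
  have J: "(LINT x|lborel. (c * u x + v x)^2) = c^2 * (LINT x|lborel. (u x)^2)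
     + 2 * c * (LINT x|lborel. u x * v x) + (LINT x|lborel. (v x)^2)"
  proof -
    have "(LINT x|lborel. (c * u x + v x)^2) =
        (LINT x|lborel. c^2 * (u x)^2 + (2 * c) * (u x * v x) + (v x)^2)"
      by (intro Bochner_Integration.integral_cong) (auto simp: power2_eq_square algebra_simps)
    thus ?thesis using i uv by simp
  qed
  have E: "Efun f \<beta> w = ((LINT x|lborel. (wd (wd u) x)^2) - \<beta> * (LINT x|lborel. (wd u x)^2)
      + (LINT x|lborel. (u x)^2) + (LINT x|lborel. (v x)^2)) / 2 - Kfun f p u / (p + 1)"
    using i K p unfolding Efun_def w Kfun_def by simp
  show ?thesis
    unfolding Lfun_def E unfolding Qfun_def w fst_conv snd_conv J Ifun_expand[OF u] by (simp add: field_simps)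
qed

end

section \<open>Positivity of m and minimization on the Nehari set\<close>

locale boussinesq = homogeneous_nonlinearity +
  fixes \<beta> c :: real
  assumes F_pos: "\<exists>s. Fprim f s > 0"
    and c: "c^2 < 1" and \<beta>: "\<beta> < 2 * sqrt (1 - c^2)"
begin

abbreviation "I \<equiv> Ifun \<beta> c"
abbreviation "K \<equiv> Kfun f p"
abbreviation "J w \<equiv> LINT x|lborel. (c * fst w x + snd w x)^2"
abbreviation "m \<equiv> mval f p \<beta> c"

lemma Ifun_nonneg: "H2 u \<Longrightarrow> I u \<ge> 0"
  and Ifun_zero: "H2 u \<Longrightarrow> I u = 0 \<Longrightarrow> AE x in lborel. u x = 0"
proof -
  obtain C where C: "C > 0" "\<And>u. H2 u \<Longrightarrow> (LINT x|lborel. (u x)^2) + (LINT x|lborel. (wd u x)^2) \<le> C * I u"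
    using Ifun_coercive[OF c \<beta>] by blast
  have nn: "(LINT x|lborel. (u x)^2) \<ge> 0" for u :: "real \<Rightarrow> real" by simp
  show "I u \<ge> 0" if u: "H2 u"
  proof -
    have "0 \<le> C * I u" using C(2)[OF u] nn[of u] nn[of "wd u"] by linarith
    thus ?thesis using C(1) by (simp add: zero_le_mult_iff)
  qed
  show "AE x in lborel. u x = 0" if u: "H2 u" and "I u = 0"
  proof -
    have "(LINT x|lborel. (u x)^2) = 0" using C(2)[OF u] nn[of u] nn[of "wd u"] unfolding \<open>I u = 0\<close> by linarith
    thus ?thesis using integral_nonneg_eq_0_iff_AE[of lborel "\<lambda>x. (u x)^2"] H2D(1)[OF u] by (simp add: L2_def)
  qed
qed

lemma Ifun_pos: "H2 u \<Longrightarrow> K u > 0 \<Longrightarrow> I u > 0"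
  using Ifun_nonneg[of u] Ifun_zero[of u] Kfun_zero[of u] by (cases "I u = 0") auto

text \<open>By coercivity \<open>C * I u\<close> bounds both the supremum and the integral of u^2,
  so \<open>Kfun_bound\<close> gives K \<le> growth (C I)^((p+1)/2). The power 2/(p+1) makes this
  linear in I.\<close>

lemma quotient_lower_bound:
  obtains \<mu> where "\<mu> > 0" "\<And>u. H2 u \<Longrightarrow> K u > 0 \<Longrightarrow> \<mu> \<le> I u / K u powr (2 / (p + 1))"
proof -
  obtain C where C: "C > 0" "\<And>u. H2 u \<Longrightarrow> (LINT x|lborel. (u x)^2) + (LINT x|lborel. (wd u x)^2) \<le> C * I u"
    using Ifun_coercive[OF c \<beta>] by blast
  define \<mu> where "\<mu> = 1 / (growth powr (2 / (p + 1)) * C)"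
  have "\<mu> > 0" using C growth_pos by (simp add: \<mu>_def)
  moreover have "\<mu> \<le> I u / K u powr (2 / (p + 1))" if u: "H2 u" and K: "K u > 0" for u
  proof -
    note h = H2D[OF u]
    have I: "I u > 0" by (rule Ifun_pos[OF u K])
    have "AE x in lborel. (u x)^2 \<le> C * I u"
      using H1_sup_bound[OF h(1-3)] by eventually_elim (use C(2)[OF u] in linarith)
    moreover have "(LINT x|lborel. (wd u x)^2) \<ge> 0" by simp
    hence "(LINT x|lborel. (u x)^2) \<le> C * I u" using C(2)[OF u] by linarith
    ultimately have "K u \<le> growth * (C * I u) powr ((p + 1) / 2)" by (intro Kfun_bound h)
    hence "K u powr (2 / (p + 1)) \<le> (growth * (C * I u) powr ((p + 1) / 2)) powr (2 / (p + 1))"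
      using K p by (intro powr_mono2) auto
    also have "\<dots> = growth powr (2 / (p + 1)) * (C * I u)"
    proof -
      have "(p + 1) / 2 * (2 / (p + 1)) = 1" using p by simp
      hence "((C * I u) powr ((p + 1) / 2)) powr (2 / (p + 1)) = C * I u"
        unfolding powr_powr using C(1) I by (simp only: powr_one mult_pos_pos less_imp_le)
      thus ?thesis using growth_pos C(1) I by (simp only: powr_mult less_imp_le powr_ge_zero)
    qed
    finally show ?thesis using K C growth_pos by (simp add: \<mu>_def field_simps)
  qed
  ultimately show ?thesis using that by blast
qed

text \<open>A real \<open>Inf\<close> is informative only for a nonempty set bounded below:
  \<open>F_pos\<close> supplies an admissible \<open>u\<close>, and
  \<open>quotient_lower_bound\<close> a positive lower bound.\<close>

lemma mval_pos: "m > 0"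
  and mval_le: "\<And>u. H2 u \<Longrightarrow> K u > 0 \<Longrightarrow> m \<le> I u / K u powr (2 / (p + 1))"
  and mval_greatest: "\<And>r. (\<And>u. H2 u \<Longrightarrow> K u > 0 \<Longrightarrow> r \<le> I u / K u powr (2 / (p + 1))) \<Longrightarrow> r \<le> m"
proof -
  define S where "S = {I u / K u powr (2 / (p + 1)) | u. H2 u \<and> K u > 0}"
  have m: "m = Inf S" by (simp add: mval_def S_def)
  obtain \<mu> where mu: "\<mu> > 0" "\<And>u. H2 u \<Longrightarrow> K u > 0 \<Longrightarrow> \<mu> \<le> I u / K u powr (2 / (p + 1))"
    using quotient_lower_bound by blast
  have ne: "S \<noteq> {}" using F_pos Kfun_pos_exists unfolding S_def by blast
  show great: "r \<le> m" if "\<And>u. H2 u \<Longrightarrow> K u > 0 \<Longrightarrow> r \<le> I u / K u powr (2 / (p + 1))" for r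
    unfolding m using ne that by (intro cInf_greatest) (auto simp: S_def)
  show "m > 0" using great[of \<mu>] mu by force
  have "bdd_below S" using mu(2) unfolding S_def by (intro bdd_belowI[of _ \<mu>]) blast
  thus "m \<le> I u / K u powr (2 / (p + 1))" if "H2 u" "K u > 0" for u
    unfolding m using that by (intro cInf_lower) (auto simp: S_def)
qed

lemma mval_le_power:
  assumes u: "H2 u" and K: "K u > 0" and IK: "I u \<le> K u"
  shows "m powr ((p + 1) / (p - 1)) \<le> K u"
proof -
  have "m \<le> I u / K u powr (2 / (p + 1))" by (rule mval_le[OF u K])
  also have "\<dots> \<le> K u / K u powr (2 / (p + 1))" using IK K by (simp add: divide_right_mono)
  also have "\<dots> = K u powr (1 - 2 / (p + 1))" using K by (simp add: powr_diff)
  also have "1 - 2 / (p + 1) = (p - 1) / (p + 1)" using p by (simp add: field_simps)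
  finally have "m powr ((p + 1) / (p - 1)) \<le> (K u powr ((p - 1) / (p + 1))) powr ((p + 1) / (p - 1))"
    using mval_pos p by (intro powr_mono2) auto
  also have "\<dots> = K u" using K p by (simp add: powr_powr)
  finally show ?thesis .
qed

lemma nehariD:
  assumes "w \<in> nehari f p \<beta> c"
  shows "K (fst w) > 0" "K (fst w) = I (fst w) + J w" "Lfun f \<beta> c w = (1/2 - 1/(p+1)) * K (fst w)"
proof -
  obtain u v where w: "w = (u, v)" by (cases w)
  have X: "inX w" "\<not> (AE x in lborel. u x = 0 \<and> v x = 0)" "Pfun f p \<beta> c w = 0"
    using assms by (auto simp: nehari_def w)
  have u: "H2 u" and v: "L2 v" using X(1) by (auto simp: inX_def w)
  show KIJ: "K (fst w) = I (fst w) + J w" using X(3) by (simp add: Pfun_def)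
  have J: "J w \<ge> 0" by simp
  show "K (fst w) > 0"
  proof (rule ccontr)
    assume "\<not> ?thesis"
    \<comment> \<open>K = I + J with both summands nonnegative, so K \<le> 0 forces both to vanish;
      then \<open>u\<close>, and with it \<open>v\<close>, is zero almost everywhere.\<close>
    hence "I u = 0" "J w = 0" using KIJ J Ifun_nonneg[OF u] unfolding w fst_conv by linarith+
    hence u0: "AE x in lborel. u x = 0" by (intro Ifun_zero[OF u])
    have "L2 (\<lambda>x. c * u x + v x)" by (intro L2_add L2_scale v H2D(1)[OF u])
    hence "AE x in lborel. c * u x + v x = 0"
      using \<open>J w = 0\<close> integral_nonneg_eq_0_iff_AE[of lborel "\<lambda>x. (c * u x + v x)^2"] by (simp add: L2_def w)
    with u0 have "AE x in lborel. u x = 0 \<and> v x = 0" by eventually_elim simp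
    thus False using X(2) by blast
  qed
  show "Lfun f \<beta> c w = (1/2 - 1/(p+1)) * K (fst w)"
    unfolding Lfun_expand[OF X(1)] KIJ[symmetric] by (simp add: algebra_simps)
qed

lemma nehari_scaling:
  assumes u: "H2 u" and K: "K u > 0"
  obtains w where "w \<in> nehari f p \<beta> c"
    "Lfun f \<beta> c w = (1/2 - 1/(p+1)) * (I u / K u powr (2 / (p + 1))) powr ((p + 1) / (p - 1))"
proof -
  have I: "I u > 0" by (rule Ifun_pos[OF u K])
  \<comment> \<open>Solves t^(p+1) K = t^2 I, the Nehari condition for the rescaled function once
    the second component has removed J.\<close>
  define t where "t = (I u / K u) powr (1 / (p - 1))"
  have t: "t > 0" using I K by (simp add: t_def)
  define w where "w = ((\<lambda>x. t * u x), (\<lambda>x. - c * (t * u x)))"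
  have Hu: "H2 (\<lambda>x. t * u x)" by (rule H2_scale[OF u])
  have X: "inX w" unfolding inX_def w_def fst_conv snd_conv by (intro conjI Hu L2_scale H2D(1)[OF u])
  have Kt: "K (\<lambda>x. t * u x) = t powr (p + 1) * K u" by (rule Kfun_scale[OF t])
  have "t powr (p - 1) = I u / K u" using I K p by (simp add: t_def powr_powr)
  moreover have "t powr (p + 1) = t powr (p - 1) * t^2"
  proof -
    have "p + 1 = (p - 1) + 2" by simp
    hence "t powr (p + 1) = t powr (p - 1) * t powr 2" by (metis powr_add)
    thus ?thesis using t by (simp add: powr_numeral)
  qed
  ultimately have KI: "K (\<lambda>x. t * u x) = t^2 * I u" using K by (simp add: Kt)
  have "Pfun f p \<beta> c w = 0" unfolding Pfun_def w_def by (simp add: KI Ifun_scale[OF u])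
  moreover have "\<not> (AE x in lborel. fst w x = 0 \<and> snd w x = 0)"
  proof
    assume "AE x in lborel. fst w x = 0 \<and> snd w x = 0"
    hence "AE x in lborel. t * u x = 0" by eventually_elim (simp add: w_def)
    from Kfun_zero[OF this] show False using t K by (simp add: Kt)
  qed
  ultimately have w: "w \<in> nehari f p \<beta> c" using X by (simp add: nehari_def)
  have "t^2 * I u = (I u / K u) powr (2 / (p - 1)) * I u"
  proof -
    have "t^2 = t powr 2" using t by (simp add: powr_numeral)
    thus ?thesis by (simp add: t_def powr_powr)
  qed
  also have "\<dots> = I u powr (2 / (p - 1) + 1) / K u powr (2 / (p - 1))"
    using I K by (simp add: powr_divide powr_add)
  also have "2 / (p - 1) + 1 = (p + 1) / (p - 1)" using p by (simp add: field_simps)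
  also have "K u powr (2 / (p - 1)) = (K u powr (2 / (p + 1))) powr ((p + 1) / (p - 1))"
  proof -
    have "2 / (p + 1) * ((p + 1) / (p - 1)) = 2 / (p - 1)" using p by (simp del: mult_divide_mult_cancel_left_if add: divide_simps)
    thus ?thesis by (simp only: powr_powr)
  qed
  also have "I u powr ((p + 1) / (p - 1)) / \<dots> = (I u / K u powr (2 / (p + 1))) powr ((p + 1) / (p - 1))"
    using I K by (simp add: powr_divide)
  finally show ?thesis using that[OF w] nehariD(3)[OF w] by (simp add: w_def KI)
qed

text \<open>The lower bound is \<open>mval_le_power\<close> applied at each Nehari point; the upper
  bound comes from \<open>nehari_scaling\<close>.\<close>

lemma Inf_Lfun_nehari:
  "Inf (Lfun f \<beta> c ` nehari f p \<beta> c) = (1/2 - 1/(p+1)) * m powr ((p + 1) / (p - 1))"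
proof (rule antisym)
  define \<kappa> where "\<kappa> = 1/2 - 1/(p+1)"
  have k: "\<kappa> > 0" using p by (simp add: \<kappa>_def field_simps)
  define X where "X = Inf (Lfun f \<beta> c ` nehari f p \<beta> c)"
  have lower: "\<kappa> * m powr ((p + 1) / (p - 1)) \<le> Lfun f \<beta> c w" if w: "w \<in> nehari f p \<beta> c" for w
  proof -
    have "H2 (fst w)" using w by (simp add: nehari_def inX_def)
    moreover have "J w \<ge> 0" by simp
    ultimately show ?thesis
      using nehariD[OF w] mval_le_power[of "fst w"] k by (simp add: \<kappa>_def[symmetric])
  qed
  obtain u0 where "H2 u0" "K u0 > 0" using F_pos Kfun_pos_exists by blast
  hence ne: "nehari f p \<beta> c \<noteq> {}" using nehari_scaling by blast
  thus XL: "(1/2 - 1/(p+1)) * m powr ((p + 1) / (p - 1)) \<le> Inf (Lfun f \<beta> c ` nehari f p \<beta> c)"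
    using lower by (intro cInf_greatest) (auto simp: \<kappa>_def)
  hence X0: "X \<ge> 0" using k unfolding X_def[symmetric] \<kappa>_def[symmetric]
    by (smt (verit) mult_nonneg_nonneg powr_ge_zero)
  \<comment> \<open>Existence of a minimizer for \<open>m\<close> is not assumed, so a power of the
    infimum is shown to be a lower bound for every quotient. \<open>X0\<close> permits raising to
    powers and undoing them.\<close>
  have "(X / \<kappa>) powr ((p - 1) / (p + 1)) \<le> m"
  proof (rule mval_greatest)
    fix u assume u: "H2 u" "K u > 0"
    define r where "r = I u / K u powr (2 / (p + 1))"
    have r: "r > 0" using Ifun_pos[OF u] u by (simp add: r_def)
    obtain w where w: "w \<in> nehari f p \<beta> c" "Lfun f \<beta> c w = \<kappa> * r powr ((p + 1) / (p - 1))"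
      using nehari_scaling[OF u] unfolding \<kappa>_def r_def by blast
    have "X \<le> Lfun f \<beta> c w"
      unfolding X_def by (intro cInf_lower imageI w(1) bdd_belowI2) (rule lower)
    hence "X / \<kappa> \<le> r powr ((p + 1) / (p - 1))" using w k by (simp add: field_simps)
    hence "(X / \<kappa>) powr ((p - 1) / (p + 1)) \<le> (r powr ((p + 1) / (p - 1))) powr ((p - 1) / (p + 1))"
      using X0 k p by (intro powr_mono2) auto
    also have "\<dots> = r" using r p by (simp add: powr_powr)
    finally show "(X / \<kappa>) powr ((p - 1) / (p + 1)) \<le> I u / K u powr (2 / (p + 1))" by (simp add: r_def)
  qed
  hence "((X / \<kappa>) powr ((p - 1) / (p + 1))) powr ((p + 1) / (p - 1)) \<le> m powr ((p + 1) / (p - 1))"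
    using p by (intro powr_mono2) auto
  hence "X / \<kappa> \<le> m powr ((p + 1) / (p - 1))" using X0 k p by (simp add: powr_powr)
  thus "Inf (Lfun f \<beta> c ` nehari f p \<beta> c) \<le> (1/2 - 1/(p+1)) * m powr ((p + 1) / (p - 1))"
    unfolding X_def[symmetric] \<kappa>_def[symmetric] using k by (simp add: field_simps)
qed

text \<open>Both sides reduce to scalar relations: membership in the ground states means I = K = M
  and J = 0, while a minimizing Nehari point has K = I + J and K = M.\<close>

lemma ground_state_iff:
  assumes X: "inX w"
  shows "w \<in> vec_ground_states f p \<beta> c \<longleftrightarrow>
     w \<in> nehari f p \<beta> c \<and> Lfun f \<beta> c w = Inf (Lfun f \<beta> c ` nehari f p \<beta> c)"
proof -
  obtain u v where w: "w = (u, v)" by (cases w)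
  have u: "H2 u" and v: "L2 v" using X by (auto simp: inX_def w)
  define \<kappa> where "\<kappa> = 1/2 - 1/(p+1)"
  have k: "\<kappa> > 0" using p by (simp add: \<kappa>_def field_simps)
  define M where "M = m powr ((p + 1) / (p - 1))"
  have M: "M > 0" using mval_pos by (simp add: M_def)
  have Jiff: "J w = 0 \<longleftrightarrow> (AE x in lborel. v x = - c * u x)"
  proof -
    have "L2 (\<lambda>x. c * u x + v x)" by (intro L2_add L2_scale v H2D(1)[OF u])
    hence "J w = 0 \<longleftrightarrow> (AE x in lborel. (c * u x + v x)^2 = 0)"
      by (subst integral_nonneg_eq_0_iff_AE) (auto simp: L2_def w)
    also have "\<dots> \<longleftrightarrow> (AE x in lborel. v x = - c * u x)"
      by (intro AE_cong) (auto simp: add_eq_0_iff)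
    finally show ?thesis .
  qed
  have gs: "w \<in> vec_ground_states f p \<beta> c \<longleftrightarrow> I u = K u \<and> K u = M \<and> J w = 0"
    unfolding Jiff using u v by (auto simp: vec_ground_states_def ground_states_def w M_def)
  have Pw: "Pfun f p \<beta> c w = I u - K u + J w" by (simp add: Pfun_def w)
  show ?thesis
    unfolding gs Inf_Lfun_nehari \<kappa>_def[symmetric] M_def[symmetric]
  proof (intro iffI conjI)
    assume *: "I u = K u \<and> K u = M \<and> J w = 0"
    have "\<not> (AE x in lborel. fst w x = 0 \<and> snd w x = 0)"
    proof
      assume "AE x in lborel. fst w x = 0 \<and> snd w x = 0"
      hence "AE x in lborel. u x = 0" by eventually_elim (simp add: w)
      from Kfun_zero[OF this] show False using * M by simp
    qed
    thus N: "w \<in> nehari f p \<beta> c" using X Pw * by (simp add: nehari_def)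
    show "Lfun f \<beta> c w = \<kappa> * M" using nehariD(3)[OF N] * by (simp add: w \<kappa>_def)
  next
    assume *: "w \<in> nehari f p \<beta> c \<and> Lfun f \<beta> c w = \<kappa> * M"
    note N = nehariD[OF conjunct1[OF *], unfolded \<kappa>_def[symmetric]]
    show KM: "K u = M" using N(3) * k by (simp add: w)
    have "m * M powr (2 / (p + 1)) \<le> I u"
      using mval_le[OF u] N(1) KM by (simp add: w field_simps)
    \<comment> \<open>Since 1 + 2/(p-1) = (p+1)/(p-1), the minimality bound reads M \<le> I. With I
      + J = K = M and J \<ge> 0 this leaves only J = 0.\<close>
    moreover have "m * M powr (2 / (p + 1)) = M"
    proof -
      have "m * M powr (2 / (p + 1)) = m powr (1 + 2 / (p - 1))"
      proof -
        have "(p + 1) / (p - 1) * (2 / (p + 1)) = 2 / (p - 1)" using p by (simp del: mult_divide_mult_cancel_left_if add: divide_simps)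
        hence "M powr (2 / (p + 1)) = m powr (2 / (p - 1))" by (simp only: M_def powr_powr)
        thus ?thesis using mval_pos by (simp add: powr_add)
      qed
      also have "1 + 2 / (p - 1) = (p + 1) / (p - 1)" using p by (simp add: field_simps)
      finally show ?thesis by (simp add: M_def)
    qed
    moreover have "J w \<ge> 0" by simp
    ultimately show "J w = 0" "I u = K u" using N(2) KM unfolding w fst_conv by linarith+
  qed
qed

end

theorem mainTheorem1:
  fixes f :: "real \<Rightarrow> real" and p \<beta> c :: real
    and \<phi> :: "(real \<Rightarrow> real) \<times> (real \<Rightarrow> real)"
  assumes p: "p > 1"
    and f_C2: "\<exists>f' f''. (\<forall>s. (f has_real_derivative f' s) (at s)) \<and>
                 (\<forall>s. (f' has_real_derivative f'' s) (at s)) \<and> continuous_on UNIV f''"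
    and f_hom: "\<forall>t>0. \<forall>s. f (t * s) = t powr p * f s"
    and F_pos: "\<exists>s. Fprim f s > 0"
    and c: "c^2 < 1"
    and \<beta>: "\<beta> < 2 * sqrt (1 - c^2)"
    and \<phi>X: "inX \<phi>"
  shows "\<phi> \<in> vec_ground_states f p \<beta> c \<longleftrightarrow>
         (\<phi> \<in> nehari f p \<beta> c \<and> Lfun f \<beta> c \<phi> = Inf (Lfun f \<beta> c ` nehari f p \<beta> c))"
proof -
  obtain f' where f': "\<And>s. (f has_real_derivative f' s) (at s)" using f_C2 by blast
  interpret boussinesq f p \<beta> c
  proof
    show "continuous_on UNIV f" using f' DERIV_isCont continuous_at_imp_continuous_on by blast
    show "f (t * s) = t powr p * f s" if "t > 0" for t s using f_hom that by blast
    show "(p + 1) * Fprim f s = s * f s" for s by (rule Fprim_homogeneous[OF p f']) (use f_hom in blast)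
  qed (fact p F_pos c \<beta>)+
  show ?thesis by (rule ground_state_iff[OF \<phi>X])
qed

end
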